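(* Consider the Gaussian PIMAC with received signals $Y_1=X_1+X_2+h_{31}X_3+Z_1$ and $Y_2=h_{12}X_1+h_{22}X_2+X_3+Z_2$, real channel coefficients $h_{12},h_{22},h_{31}$, and power constraints $P_1,P_2,P_3$. If $h_{31}^2\leq 1$, then its sum-capacity satisfies $$C_\Sigma\leq \frac{1}{2}\log\left(1+\frac{P_1+P_2}{1+h_{31}^2P_3}\right)+\frac{1}{2}\log(1+P_3).$$
   Context: In the PIMAC, $Z_1,Z_2$ are i.i.d. (over time) additive white Gaussian noises with $Z_j\sim\mathcal{N}(0,1)$. Transmitter $i\in\{1,2,3\}$ encodes a message $m_i$, chosen uniformly and independently from $\{1,\dots,2^{nR_i}\}$, into a codeword $X_i^n\in\mathbb{R}^n$ with $\frac{1}{n}\sum_{j=1}^n\mathbb{E}[X_{i,j}^2]\leq P_i$. Receiver 1 decodes $(\hat m_1,\hat m_2)$ from $Y_1^n$ and receiver 2 decodes $\hat m_3$ from $Y_2^n$. A rate triple $(R_1,R_2,R_3)$ is achievable if there is a sequence of such codes with average probability that some $\hat m_i\neq m_i$ tending to $0$ as $n\to\infty$; the capacity region $\mathcal{C}$ is the set of achievable triples and the sum-capacity is $C_\Sigma=\max_{(R_1,R_2,R_3)\in\mathcal{C}}(R_1+R_2+R_3)$. Logarithms are base 2. *)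

theory Defs
  imports "HOL-Probability.Probability"
begin

definition msg_num :: "nat \<Rightarrow> real \<Rightarrow> nat" where
  "msg_num n R = nat \<lceil>2 powr (real n * R)\<rceil>"

definition noise :: "nat \<Rightarrow> (nat \<Rightarrow> real) measure" where
  "noise n = PiM {..<n} (\<lambda>_. density lborel std_normal_density)"

text \<open>Average power constraint with uniformly distributed message in {1..M}:
  (1/n) sum_j E[X_j^2] <= P, where x m j is the j-th symbol of the codeword of m.\<close>
definition power_ok :: "nat \<Rightarrow> nat \<Rightarrow> (nat \<Rightarrow> nat \<Rightarrow> real) \<Rightarrow> real \<Rightarrow> bool" where
  "power_ok n M x P \<longleftrightarrow>
     (1 / real n) * (\<Sum>j<n. (1 / real M) * (\<Sum>m\<in>{1..M}. (x m j)\<^sup>2)) \<le> P"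

definition pimac_error ::
  "real \<Rightarrow> real \<Rightarrow> real \<Rightarrow> nat \<Rightarrow> nat \<Rightarrow> nat \<Rightarrow> nat \<Rightarrow>
   (nat \<Rightarrow> nat \<Rightarrow> real) \<Rightarrow> (nat \<Rightarrow> nat \<Rightarrow> real) \<Rightarrow> (nat \<Rightarrow> nat \<Rightarrow> real) \<Rightarrow>
   ((nat \<Rightarrow> real) \<Rightarrow> nat \<times> nat) \<Rightarrow> ((nat \<Rightarrow> real) \<Rightarrow> nat) \<Rightarrow> real" where
  "pimac_error h12 h22 h31 n M1 M2 M3 x1 x2 x3 d1 d2 =
     (1 / (real M1 * real M2 * real M3)) *
     (\<Sum>m1\<in>{1..M1}. \<Sum>m2\<in>{1..M2}. \<Sum>m3\<in>{1..M3}.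
        measure (noise n \<Otimes>\<^sub>M noise n)
          {z \<in> space (noise n \<Otimes>\<^sub>M noise n).
             d1 (\<lambda>j\<in>{..<n}. x1 m1 j + x2 m2 j + h31 * x3 m3 j + fst z j) \<noteq> (m1, m2) \<or>
             d2 (\<lambda>j\<in>{..<n}. h12 * x1 m1 j + h22 * x2 m2 j + x3 m3 j + snd z j) \<noteq> m3})"

definition pimac_code ::
  "nat \<Rightarrow> real \<Rightarrow> real \<Rightarrow> real \<Rightarrow> real \<Rightarrow> real \<Rightarrow> real \<Rightarrow>
   (nat \<Rightarrow> nat \<Rightarrow> real) \<Rightarrow> (nat \<Rightarrow> nat \<Rightarrow> real) \<Rightarrow> (nat \<Rightarrow> nat \<Rightarrow> real) \<Rightarrow>
   ((nat \<Rightarrow> real) \<Rightarrow> nat \<times> nat) \<Rightarrow> ((nat \<Rightarrow> real) \<Rightarrow> nat) \<Rightarrow> bool" where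
  "pimac_code n R1 R2 R3 P1 P2 P3 x1 x2 x3 d1 d2 \<longleftrightarrow>
     power_ok n (msg_num n R1) x1 P1 \<and>
     power_ok n (msg_num n R2) x2 P2 \<and>
     power_ok n (msg_num n R3) x3 P3 \<and>
     d1 \<in> measurable (PiM {..<n} (\<lambda>_. borel)) (count_space UNIV) \<and>
     d2 \<in> measurable (PiM {..<n} (\<lambda>_. borel)) (count_space UNIV)"

definition pimac_achievable ::
  "real \<Rightarrow> real \<Rightarrow> real \<Rightarrow> real \<Rightarrow> real \<Rightarrow> real \<Rightarrow> real \<times> real \<times> real \<Rightarrow> bool" where
  "pimac_achievable h12 h22 h31 P1 P2 P3 R \<longleftrightarrow>
     (case R of (R1, R2, R3) \<Rightarrow>
        R1 \<ge> 0 \<and> R2 \<ge> 0 \<and> R3 \<ge> 0 \<and>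
        (\<exists>x1 x2 x3 :: nat \<Rightarrow> nat \<Rightarrow> nat \<Rightarrow> real.
         \<exists>d1 :: nat \<Rightarrow> (nat \<Rightarrow> real) \<Rightarrow> nat \<times> nat. \<exists>d2 :: nat \<Rightarrow> (nat \<Rightarrow> real) \<Rightarrow> nat.
           (\<forall>n\<ge>1. pimac_code n R1 R2 R3 P1 P2 P3 (x1 n) (x2 n) (x3 n) (d1 n) (d2 n)) \<and>
           (\<lambda>n. pimac_error h12 h22 h31 n (msg_num n R1) (msg_num n R2) (msg_num n R3)
                   (x1 n) (x2 n) (x3 n) (d1 n) (d2 n)) \<longlonglongrightarrow> 0))"

definition pimac_capacity_region ::
  "real \<Rightarrow> real \<Rightarrow> real \<Rightarrow> real \<Rightarrow> real \<Rightarrow> real \<Rightarrow> (real \<times> real \<times> real) set" where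
  "pimac_capacity_region h12 h22 h31 P1 P2 P3 = {R. pimac_achievable h12 h22 h31 P1 P2 P3 R}"

definition pimac_sum_capacity ::
  "real \<Rightarrow> real \<Rightarrow> real \<Rightarrow> real \<Rightarrow> real \<Rightarrow> real \<Rightarrow> real" where
  "pimac_sum_capacity h12 h22 h31 P1 P2 P3 =
     Sup ((\<lambda>(R1, R2, R3). R1 + R2 + R3) ` pimac_capacity_region h12 h22 h31 P1 P2 P3)"

end

theory Submission
  imports Defs
begin

text \<open>
  The converse is a single Gaussian change of measure.  Put \<open>s\<^sup>2 = 1 - h\<^sub>3\<^sub>1\<^sup>2\<close>.  Errors at the two
  receivers depend only on the marginals of the two noises, so with independent standard Gaussian
  vectors \<open>Z\<close>, \<open>W\<close> the noise of receiver 2 may be taken to be \<open>h\<^sub>3\<^sub>1 Z + s W\<close>, where \<open>Z\<close> is the noise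
  of receiver 1.  Given \<open>x\<^sub>1\<close>, \<open>x\<^sub>2\<close>, receiver 2 is then a function of \<open>Y = x\<^sub>1 + x\<^sub>2 + U\<close> with
  \<open>U = h\<^sub>3\<^sub>1 x\<^sub>3 + Z\<close>, and of \<open>T = s x\<^sub>3 + W\<close>, because \<open>x\<^sub>3 + h\<^sub>3\<^sub>1 Z + s W = h\<^sub>3\<^sub>1 U + s T\<close>.

  Compare the true law of \<open>(Y, T)\<close> with the one under which \<open>Y\<close> is Gaussian independently of all
  messages and \<open>T\<close> is Gaussian around \<open>b (Y - x\<^sub>1 - x\<^sub>2)\<close>, the optimal linear estimate of \<open>T\<close> from
  \<open>U\<close>.  Under the second law all messages are decoded correctly with probability at most
  \<open>1 / (M\<^sub>1 M\<^sub>2 M\<^sub>3)\<close>, since \<open>Y\<close> carries no information on \<open>(m\<^sub>1, m\<^sub>2)\<close> and, given these, \<open>(Y, T)\<close>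
  carries none on \<open>m\<^sub>3\<close>.  The expected log-likelihood ratio is a quadratic expression in the
  codewords, which the power constraints bound by \<open>n\<close> times the claimed sum rate; Jensen's
  inequality (through \<open>ln x \<le> x - 1\<close>) then gives a Fano-type bound.
\<close>

section \<open>Gaussian noise vectors\<close>

lemma prob_space_noise: "prob_space (noise n)"
  unfolding noise_def
  by (rule prob_space_PiM) (simp add: prob_space_normal_density)

text \<open>Both sides agree on boxes, where the integral of a product of one-variable functions
  factors. A density with respect to Lebesgue measure is what makes the change of measure and the
  shift by a codeword computable.\<close>

lemma noise_eq_density:
  "noise n = density (PiM {..<n} (\<lambda>_. lborel)) (\<lambda>z. \<Prod>j<n. ennreal (std_normal_density (z j)))"
proof -
  interpret N: product_sigma_finite "\<lambda>_::nat. density lborel std_normal_density"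
    using real_dist_normal_dist
    by (simp add: product_sigma_finite_def real_distribution_def prob_space_imp_sigma_finite)
  interpret L: product_sigma_finite "\<lambda>_::nat. lborel :: real measure"
    by (simp add: product_sigma_finite_def sigma_finite_lborel)
  let ?g = "\<lambda>z. \<Prod>j<n. ennreal (std_normal_density (z j))"
  have "density (PiM {..<n} (\<lambda>_. lborel)) ?g = noise n"
    unfolding noise_def
  proof (rule N.PiM_eqI)
    show "sets (density (Pi\<^sub>M {..<n} (\<lambda>_. lborel)) ?g) =
        sets (Pi\<^sub>M {..<n} (\<lambda>_. density lborel std_normal_density))"
      by (simp cong: sets_PiM_cong)
  next
    fix A :: "nat \<Rightarrow> real set"
    assume A: "\<And>i. i \<in> {..<n} \<Longrightarrow> A i \<in> sets (density lborel std_normal_density)"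
    have *: "Pi\<^sub>E {..<n} A \<in> sets (Pi\<^sub>M {..<n} (\<lambda>_. lborel))"
      using A by (intro sets_PiM_I_finite) auto
    have "emeasure (density (PiM {..<n} (\<lambda>_. lborel)) ?g) (Pi\<^sub>E {..<n} A)
        = (\<integral>\<^sup>+z. ?g z * indicator (Pi\<^sub>E {..<n} A) z \<partial>PiM {..<n} (\<lambda>_. lborel))"
      using * by (subst emeasure_density) auto
    also have "\<dots> = (\<integral>\<^sup>+z. (\<Prod>j<n. ennreal (std_normal_density (z j)) * indicator (A j) (z j)) \<partial>PiM {..<n} (\<lambda>_. lborel))"
    proof (rule nn_integral_cong)
      fix z assume z: "z \<in> space (PiM {..<n} (\<lambda>_. lborel :: real measure))"
      have "indicator (Pi\<^sub>E {..<n} A) z = (\<Prod>j<n. indicator (A j) (z j) :: ennreal)"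
        using z by (auto simp: indicator_def space_PiM PiE_iff prod_zero_iff split: if_splits)
      then show "?g z * indicator (Pi\<^sub>E {..<n} A) z = (\<Prod>j<n. ennreal (std_normal_density (z j)) * indicator (A j) (z j))"
        by (simp add: prod.distrib)
    qed
    also have "\<dots> = (\<Prod>j<n. \<integral>\<^sup>+x. ennreal (std_normal_density x) * indicator (A j) x \<partial>lborel)"
      using A by (intro L.product_nn_integral_prod) auto
    also have "\<dots> = (\<Prod>j<n. emeasure (density lborel std_normal_density) (A j))"
      using A by (intro prod.cong refl) (simp add: emeasure_density)
    finally show "emeasure (density (PiM {..<n} (\<lambda>_. lborel)) ?g) (Pi\<^sub>E {..<n} A)
      = (\<Prod>j<n. emeasure (density lborel std_normal_density) (A j))" .
  qed auto
  then show ?thesis by simp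
qed

text \<open>Translation invariance on the line, applied in each coordinate of a box. The restriction
  to \<open>{..<n}\<close> keeps the shifted vector in the extensional function space that carries
  the product measure.\<close>

lemma distr_PiM_lborel_plus:
  fixes c :: "nat \<Rightarrow> real"
  shows
  "distr (PiM {..<n} (\<lambda>_. lborel)) (PiM {..<n} (\<lambda>_. lborel)) (\<lambda>z. \<lambda>j\<in>{..<n}. c j + z j)
     = PiM {..<n} (\<lambda>_. lborel :: real measure)"
proof -
  interpret L: product_sigma_finite "\<lambda>_::nat. lborel :: real measure"
    by (simp add: product_sigma_finite_def sigma_finite_lborel)
  have m: "(\<lambda>z. \<lambda>j\<in>{..<n}. c j + z j) \<in> PiM {..<n} (\<lambda>_. lborel) \<rightarrow>\<^sub>M PiM {..<n} (\<lambda>_. lborel :: real measure)"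
    by measurable
  show ?thesis
  proof (rule L.PiM_eqI)
    fix A :: "nat \<Rightarrow> real set"
    assume A: "\<And>i. i \<in> {..<n} \<Longrightarrow> A i \<in> sets lborel"
    have *: "Pi\<^sub>E {..<n} A \<in> sets (Pi\<^sub>M {..<n} (\<lambda>_. lborel))"
      using A by (intro sets_PiM_I_finite) auto
    have m1: "(\<lambda>x. c i + x) -` A i \<in> sets borel" if "i < n" for i
    proof -
      have "(\<lambda>x. c i + x) -` A i \<inter> space borel \<in> sets borel"
        using A that by (intro measurable_sets[of _ borel borel]) auto
      then show ?thesis by simp
    qed
    have "(\<lambda>z. \<lambda>j\<in>{..<n}. c j + z j) -` Pi\<^sub>E {..<n} A \<inter> space (PiM {..<n} (\<lambda>_. lborel))
        = Pi\<^sub>E {..<n} (\<lambda>i. (\<lambda>x. c i + x) -` A i)"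
      by (auto simp: space_PiM PiE_iff)
    then have "emeasure (distr (PiM {..<n} (\<lambda>_. lborel)) (PiM {..<n} (\<lambda>_. lborel)) (\<lambda>z. \<lambda>j\<in>{..<n}. c j + z j)) (Pi\<^sub>E {..<n} A)
       = emeasure (PiM {..<n} (\<lambda>_. lborel)) (Pi\<^sub>E {..<n} (\<lambda>i. (\<lambda>x. c i + x) -` A i))"
      using emeasure_distr[OF m *] by simp
    also have "\<dots> = (\<Prod>i<n. emeasure lborel ((\<lambda>x. c i + x) -` A i))"
      using m1 by (intro L.emeasure_PiM) auto
    also have "\<dots> = (\<Prod>i<n. emeasure lborel (A i))"
    proof (intro prod.cong refl)
      fix i assume "i \<in> {..<n}"
      have "emeasure lborel (A i) = emeasure (distr lborel borel ((+) (c i))) (A i)"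
        by (simp add: lborel_distr_plus)
      also have "\<dots> = emeasure lborel ((\<lambda>x. c i + x) -` A i)"
        using A \<open>i \<in> _\<close> by (subst emeasure_distr) auto
      finally show "emeasure lborel ((\<lambda>x. c i + x) -` A i) = emeasure lborel (A i)" by simp
    qed
    finally show "emeasure (distr (PiM {..<n} (\<lambda>_. lborel)) (PiM {..<n} (\<lambda>_. lborel)) (\<lambda>z. \<lambda>j\<in>{..<n}. c j + z j)) (Pi\<^sub>E {..<n} A)
      = (\<Prod>i<n. emeasure lborel (A i))" .
  qed auto
qed

section \<open>Rotation invariance of standard Gaussian noise\<close>

text \<open>The two characteristic functions agree: by independence the left one is a product, and
  the exponents add up because \<open>(t * a)\<^sup>2 + (t * b)\<^sup>2 = t\<^sup>2\<close>. This
  covers a vanishing \<open>a\<close> or \<open>b\<close> too, where one summand has no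
  density.\<close>

lemma std_normal_pair_rotation:
  assumes "a\<^sup>2 + b\<^sup>2 = 1"
  shows "distr (std_normal_distribution \<Otimes>\<^sub>M std_normal_distribution) borel (\<lambda>(x, y). a * x + b * y)
    = std_normal_distribution"
proof -
  interpret N: real_distribution std_normal_distribution by (rule real_dist_normal_dist)
  interpret NN: pair_prob_space std_normal_distribution std_normal_distribution ..
  let ?P = "std_normal_distribution \<Otimes>\<^sub>M std_normal_distribution"
  let ?D = "distr ?P borel (\<lambda>(x, y). a * x + b * y)"
  interpret D: real_distribution ?D
    by (rule NN.real_distribution_distr) measurable
  have "char ?D t = char std_normal_distribution t" for t
  proof -
    have "char ?D t = (\<integral>z. iexp (t * (a * fst z + b * snd z)) \<partial>?P)"
      unfolding char_def by (subst integral_distr) (auto simp: case_prod_beta)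
    also have "\<dots> = (\<integral>x. \<integral>y. iexp (t * (a * x + b * y)) \<partial>std_normal_distribution \<partial>std_normal_distribution)"
    proof -
      have "integrable ?P (\<lambda>z. iexp (t * (a * fst z + b * snd z)))"
        by (rule NN.integrable_iexp) simp_all
      from NN.integral_fst'[OF this] show ?thesis by simp
    qed
    also have "\<dots> = (\<integral>x. iexp ((t * a) * x) * char std_normal_distribution (t * b) \<partial>std_normal_distribution)"
      unfolding char_def
      by (intro Bochner_Integration.integral_cong refl)
         (simp add: algebra_simps exp_add flip: integral_mult_right_zero)
    also have "\<dots> = char std_normal_distribution (t * a) * char std_normal_distribution (t * b)"
      unfolding char_def by simp
    also have "\<dots> = char std_normal_distribution t"
    proof -
      have "t\<^sup>2 = (t * a)\<^sup>2 + (t * b)\<^sup>2"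
        using assms by (metis distrib_left mult.right_neutral power_mult_distrib)
      then show ?thesis
        by (simp add: char_std_normal_distribution exp_add[symmetric] flip: of_real_mult of_real_add)
          (simp add: mult_exp_exp add_divide_distrib)
    qed
    finally show ?thesis .
  qed
  then show ?thesis
    by (intro Levy_uniqueness D.real_distribution_axioms N.real_distribution_axioms ext)
qed

text \<open>On a box the indicator is a product over coordinates, so the integral splits into scalar
  rotations. The lemma allows the noise of receiver 2 to be built partly from that of receiver
  1.\<close>

lemma noise_pair_rotation:
  assumes "a\<^sup>2 + b\<^sup>2 = 1"
  shows "distr (noise n \<Otimes>\<^sub>M noise n) (noise n) (\<lambda>z. \<lambda>j\<in>{..<n}. a * fst z j + b * snd z j) = noise n"
proof -
  let ?N = "std_normal_distribution"
  interpret N: product_sigma_finite "\<lambda>_::nat. std_normal_distribution"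
    using real_dist_normal_dist
    by (simp add: product_sigma_finite_def real_distribution_def prob_space_imp_sigma_finite)
  interpret n: prob_space "noise n" by (rule prob_space_noise)
  let ?f = "\<lambda>z. \<lambda>j\<in>{..<n}. a * fst z j + b * snd z j"
  have m: "?f \<in> noise n \<Otimes>\<^sub>M noise n \<rightarrow>\<^sub>M noise n"
    unfolding noise_def by measurable
  show ?thesis
    unfolding noise_def
  proof (rule N.PiM_eqI)
    fix A :: "nat \<Rightarrow> real set"
    assume A: "\<And>i. i \<in> {..<n} \<Longrightarrow> A i \<in> sets ?N"
    then have [measurable]: "i < n \<Longrightarrow> A i \<in> sets borel" for i by auto
    let ?E = "Pi\<^sub>E {..<n} A"
    have [measurable]: "?E \<in> sets (PiM {..<n} (\<lambda>_. ?N))"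
      using A by (intro sets_PiM_I_finite) auto
    have mf: "?f \<in> PiM {..<n} (\<lambda>_. ?N) \<Otimes>\<^sub>M PiM {..<n} (\<lambda>_. ?N) \<rightarrow>\<^sub>M PiM {..<n} (\<lambda>_. ?N)"
      using m unfolding noise_def .
    have "emeasure (distr (PiM {..<n} (\<lambda>_. ?N) \<Otimes>\<^sub>M PiM {..<n} (\<lambda>_. ?N)) (PiM {..<n} (\<lambda>_. ?N)) ?f) ?E
       = (\<integral>\<^sup>+z. indicator ?E (?f z) \<partial>(PiM {..<n} (\<lambda>_. ?N) \<Otimes>\<^sub>M PiM {..<n} (\<lambda>_. ?N)))"
      using mf by (subst nn_integral_distr[symmetric, OF mf]) auto
    also have "\<dots> = (\<integral>\<^sup>+x. \<integral>\<^sup>+y. indicator ?E (?f (x, y)) \<partial>PiM {..<n} (\<lambda>_. ?N) \<partial>PiM {..<n} (\<lambda>_. ?N))"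
      using measurable_compose[OF mf] n.sigma_finite_measure_axioms
      by (subst sigma_finite_measure.nn_integral_fst[symmetric]) (auto simp: noise_def)
    also have "\<dots> = (\<integral>\<^sup>+x. \<integral>\<^sup>+y. (\<Prod>j<n. indicator (A j) (a * x j + b * y j)) \<partial>PiM {..<n} (\<lambda>_. ?N) \<partial>PiM {..<n} (\<lambda>_. ?N))"
      by (intro nn_integral_cong) (auto simp: indicator_def space_PiM PiE_iff prod_zero_iff split: if_splits)
    also have "\<dots> = (\<integral>\<^sup>+x. (\<Prod>j<n. \<integral>\<^sup>+y. indicator (A j) (a * x j + b * y) \<partial>?N) \<partial>PiM {..<n} (\<lambda>_. ?N))"
      by (intro nn_integral_cong N.product_nn_integral_prod) auto
    also have "\<dots> = (\<Prod>j<n. \<integral>\<^sup>+x. \<integral>\<^sup>+y. indicator (A j) (a * x + b * y) \<partial>?N \<partial>?N)"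
      by (intro N.product_nn_integral_prod) auto
    also have "\<dots> = (\<Prod>j<n. emeasure ?N (A j))"
    proof (intro prod.cong refl)
      fix j assume "j \<in> {..<n}"
      then have [measurable]: "A j \<in> sets borel" by simp
      have "(\<integral>\<^sup>+x. \<integral>\<^sup>+y. indicator (A j) (a * x + b * y) \<partial>?N \<partial>?N)
         = (\<integral>\<^sup>+z. indicator (A j) (case z of (x, y) \<Rightarrow> a * x + b * y) \<partial>(?N \<Otimes>\<^sub>M ?N))"
        using prob_space_normal_density[of 1 0, THEN prob_space_imp_sigma_finite]
        by (subst sigma_finite_measure.nn_integral_fst[symmetric]) auto
      also have "\<dots> = emeasure ?N (A j)"
      proof -
        have "emeasure ?N (A j) = emeasure (distr (?N \<Otimes>\<^sub>M ?N) borel (\<lambda>(x, y). a * x + b * y)) (A j)"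
          by (simp add: std_normal_pair_rotation[OF assms])
        also have "\<dots> = (\<integral>\<^sup>+z. indicator (A j) z \<partial>distr (?N \<Otimes>\<^sub>M ?N) borel (\<lambda>(x, y). a * x + b * y))"
          by simp
        also have "\<dots> = (\<integral>\<^sup>+z. indicator (A j) (case z of (x, y) \<Rightarrow> a * x + b * y) \<partial>(?N \<Otimes>\<^sub>M ?N))"
          by (subst nn_integral_distr) auto
        finally show ?thesis by simp
      qed
      finally show "(\<integral>\<^sup>+x. \<integral>\<^sup>+y. indicator (A j) (a * x + b * y) \<partial>?N \<partial>?N) = emeasure ?N (A j)" .
    qed
    finally show "emeasure (distr (PiM {..<n} (\<lambda>_. ?N) \<Otimes>\<^sub>M PiM {..<n} (\<lambda>_. ?N)) (PiM {..<n} (\<lambda>_. ?N)) ?f) ?E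
       = (\<Prod>j<n. emeasure ?N (A j))" .
  qed auto
qed

section \<open>Integrals over noise vectors as Lebesgue integrals\<close>

lemma sets_noise [measurable_cong]: "sets (noise n) = sets (PiM {..<n} (\<lambda>_. borel))"
  unfolding noise_def by (intro sets_PiM_cong) auto

lemma sets_PiM_lborel [measurable_cong]:
  "sets (PiM I (\<lambda>_. lborel)) = sets (PiM I (\<lambda>_. borel))"
  by (intro sets_PiM_cong) auto

lemma nn_integral_noise:
  assumes [measurable]: "f \<in> borel_measurable (PiM {..<n} (\<lambda>_. borel))"
  shows "(\<integral>\<^sup>+z. f z \<partial>noise n)
    = (\<integral>\<^sup>+z. ennreal (\<Prod>j<n. std_normal_density (z j)) * f z \<partial>PiM {..<n} (\<lambda>_. lborel))"
proof -
  have "(\<integral>\<^sup>+z. f z \<partial>noise n)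
    = (\<integral>\<^sup>+z. (\<Prod>j<n. ennreal (std_normal_density (z j))) * f z \<partial>PiM {..<n} (\<lambda>_. lborel))"
    unfolding noise_eq_density by (subst nn_integral_density) measurable
  then show ?thesis by (simp add: prod_ennreal)
qed

lemma nn_integral_PiM_lborel_plus:
  fixes c :: "nat \<Rightarrow> real"
  assumes [measurable]: "f \<in> borel_measurable (PiM {..<n} (\<lambda>_. borel))"
  shows "(\<integral>\<^sup>+z. f (\<lambda>j\<in>{..<n}. c j + z j) \<partial>PiM {..<n} (\<lambda>_. lborel))
    = (\<integral>\<^sup>+z. f z \<partial>PiM {..<n} (\<lambda>_. lborel))"
proof -
  have "(\<lambda>z. \<lambda>j\<in>{..<n}. c j + z j) \<in> PiM {..<n} (\<lambda>_. lborel) \<rightarrow>\<^sub>M PiM {..<n} (\<lambda>_. lborel)"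
    by measurable
  then show ?thesis
    by (subst (2) distr_PiM_lborel_plus[of n c, symmetric], subst nn_integral_distr) auto
qed

section \<open>The tilted law of the outputs\<close>

text \<open>
  The likelihood ratio, as a function of the noises, for the outputs \<open>y = c + fst z\<close> and
  \<open>t = d + snd z\<close>: under the tilted law \<open>y\<close> has independent components \<open>N(\<mu>\<^sub>j, \<sigma>\<^sup>2)\<close> and, given \<open>y\<close>,
  \<open>t\<close> has independent components \<open>N(b (y\<^sub>j - k\<^sub>j), \<tau>\<^sup>2)\<close>.
\<close>

definition tilt ::
  "nat \<Rightarrow> (nat \<Rightarrow> real) \<Rightarrow> real \<Rightarrow> real \<Rightarrow> (nat \<Rightarrow> real) \<Rightarrow> real \<Rightarrow> (nat \<Rightarrow> real) \<Rightarrow> (nat \<Rightarrow> real)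
    \<Rightarrow> (nat \<Rightarrow> real) \<times> (nat \<Rightarrow> real) \<Rightarrow> real" where
  "tilt n \<mu> \<sigma> b k \<tau> c d z =
     (\<Prod>j<n. normal_density (\<mu> j) \<sigma> (c j + fst z j)
            * normal_density (b * (c j + fst z j - k j)) \<tau> (d j + snd z j)
            / (std_normal_density (fst z j) * std_normal_density (snd z j)))"

lemma measurable_tilt [measurable]:
  "tilt n \<mu> \<sigma> b k \<tau> c d \<in> borel_measurable (PiM {..<n} (\<lambda>_. borel) \<Otimes>\<^sub>M PiM {..<n} (\<lambda>_. borel))"
  unfolding tilt_def normal_density_def by measurable

text \<open>Multiplying by the noise densities cancels the denominators of \<open>tilt\<close>, and
  translation by \<open>c\<close> and \<open>d\<close> then turns noises into outputs. On the right
  \<open>c\<close> and \<open>d\<close> are gone: the second law sees the messages only through its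
  own parameters.\<close>

lemma nn_integral_tilt:
  assumes [measurable]: "F \<in> borel_measurable (PiM {..<n} (\<lambda>_. borel) \<Otimes>\<^sub>M PiM {..<n} (\<lambda>_. borel))"
  shows "(\<integral>\<^sup>+z. ennreal (tilt n \<mu> \<sigma> b k \<tau> c d z)
        * F (\<lambda>j\<in>{..<n}. c j + fst z j, \<lambda>j\<in>{..<n}. d j + snd z j) \<partial>(noise n \<Otimes>\<^sub>M noise n))
    = (\<integral>\<^sup>+y. ennreal (\<Prod>j<n. normal_density (\<mu> j) \<sigma> (y j))
        * (\<integral>\<^sup>+t. ennreal (\<Prod>j<n. normal_density (b * (y j - k j)) \<tau> (t j)) * F (y, t)
             \<partial>PiM {..<n} (\<lambda>_. lborel)) \<partial>PiM {..<n} (\<lambda>_. lborel))"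
    (is "?l = ?r")
proof -
  let ?L = "PiM {..<n} (\<lambda>_. lborel) :: (nat \<Rightarrow> real) measure"
  interpret N: prob_space "noise n" by (rule prob_space_noise)
  interpret L: product_sigma_finite "\<lambda>_::nat. lborel :: real measure"
    by (simp add: product_sigma_finite_def sigma_finite_lborel)
  interpret L: finite_product_sigma_finite "\<lambda>_::nat. lborel :: real measure" "{..<n}"
    by standard auto
  note sp = sets_eq_imp_space_eq[OF sets_PiM_lborel]
  define sc where "sc x = (\<lambda>j\<in>{..<n}. c j + x j)" for x :: "nat \<Rightarrow> real"
  define sd where "sd x = (\<lambda>j\<in>{..<n}. d j + x j)" for x :: "nat \<Rightarrow> real"
  have [measurable]: "sc \<in> PiM {..<n} (\<lambda>_. borel) \<rightarrow>\<^sub>M PiM {..<n} (\<lambda>_. borel)"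
      "sd \<in> PiM {..<n} (\<lambda>_. borel) \<rightarrow>\<^sub>M PiM {..<n} (\<lambda>_. borel)"
    unfolding sc_def[abs_def] sd_def[abs_def] by measurable
  let ?A = "\<lambda>y. ennreal (\<Prod>j<n. normal_density (\<mu> j) \<sigma> (y j))"
  let ?B = "\<lambda>y t. ennreal (\<Prod>j<n. normal_density (b * (y j - k j)) \<tau> (t j))"
  let ?\<phi> = "\<lambda>y. ennreal (\<Prod>j<n. std_normal_density (y j))"
  have [measurable]: "?\<phi> \<in> borel_measurable (PiM {..<n} (\<lambda>_. borel))"
      "?A \<in> borel_measurable (PiM {..<n} (\<lambda>_. borel))"
      "(\<lambda>p. ?B (fst p) (snd p)) \<in> borel_measurable (PiM {..<n} (\<lambda>_. borel) \<Otimes>\<^sub>M PiM {..<n} (\<lambda>_. borel))"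
    unfolding normal_density_def by measurable
  have [measurable]: "(\<lambda>p. ?B (f p) (g p)) \<in> borel_measurable M"
    if "f \<in> M \<rightarrow>\<^sub>M PiM {..<n} (\<lambda>_. borel)" "g \<in> M \<rightarrow>\<^sub>M PiM {..<n} (\<lambda>_. borel)" for f g and M :: "'x measure"
    using measurable_compose[of "\<lambda>p. (f p, g p)" M, OF _ \<open>(\<lambda>p. ?B (fst p) (snd p)) \<in> _\<close>] that by simp
  have pt: "?\<phi> x * (?\<phi> y * (ennreal (tilt n \<mu> \<sigma> b k \<tau> c d (x, y)) * w)) = ?A (sc x) * (?B (sc x) (sd y) * w)" for x y w
  proof -
    have "?\<phi> x * (?\<phi> y * ennreal (tilt n \<mu> \<sigma> b k \<tau> c d (x, y))) =
        ennreal (\<Prod>j<n. normal_density (\<mu> j) \<sigma> (c j + x j) * normal_density (b * (c j + x j - k j)) \<tau> (d j + y j))"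
    proof -
      have "std_normal_density u \<noteq> 0" for u using normal_density_pos[of 1 0 u] by simp
      then have "(\<Prod>j<n. std_normal_density (x j)) * ((\<Prod>j<n. std_normal_density (y j)) * tilt n \<mu> \<sigma> b k \<tau> c d (x, y))
        = (\<Prod>j<n. normal_density (\<mu> j) \<sigma> (c j + x j) * normal_density (b * (c j + x j - k j)) \<tau> (d j + y j))"
        unfolding tilt_def prod.distrib[symmetric] by (intro prod.cong refl) (simp add: field_simps)
      moreover have "0 \<le> tilt n \<mu> \<sigma> b k \<tau> c d (x, y)"
        unfolding tilt_def by (intro prod_nonneg) auto
      ultimately show ?thesis by (simp add: ennreal_mult[symmetric] prod_nonneg)
    qed
    also have "\<dots> = ?A (sc x) * ?B (sc x) (sd y)"
      by (simp add: ennreal_mult[symmetric] prod_nonneg prod.distrib sc_def sd_def)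
    finally show ?thesis by (simp add: mult.assoc[symmetric])
  qed
  have "?l = (\<integral>\<^sup>+x. \<integral>\<^sup>+y. ennreal (tilt n \<mu> \<sigma> b k \<tau> c d (x, y)) * F (sc x, sd y) \<partial>noise n \<partial>noise n)"
    unfolding sc_def[symmetric] sd_def[symmetric]
    by (subst N.nn_integral_fst[symmetric]) simp_all
  also have "\<dots> = (\<integral>\<^sup>+x. ?\<phi> x * (\<integral>\<^sup>+y. ?\<phi> y * (ennreal (tilt n \<mu> \<sigma> b k \<tau> c d (x, y)) * F (sc x, sd y)) \<partial>?L) \<partial>?L)"
    by (subst nn_integral_noise, simp,
        intro nn_integral_cong arg_cong2[where f = "(*)"] refl nn_integral_noise)
       (simp add: sp)
  also have "\<dots> = (\<integral>\<^sup>+x. \<integral>\<^sup>+y. ?A (sc x) * (?B (sc x) (sd y) * F (sc x, sd y)) \<partial>?L \<partial>?L)"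
    by (intro nn_integral_cong, subst nn_integral_cmult[symmetric])
       (simp_all add: sp pt)
  also have "\<dots> = (\<integral>\<^sup>+x. ?A (sc x) * (\<integral>\<^sup>+y. ?B (sc x) (sd y) * F (sc x, sd y) \<partial>?L) \<partial>?L)"
    by (intro nn_integral_cong) (subst nn_integral_cmult, simp_all add: sp)
  also have "\<dots> = (\<integral>\<^sup>+x. ?A (sc x) * (\<integral>\<^sup>+t. ?B (sc x) t * F (sc x, t) \<partial>?L) \<partial>?L)"
    unfolding sd_def by (intro nn_integral_cong arg_cong2[where f = "(*)"] refl nn_integral_PiM_lborel_plus)
       (simp add: sp)
  also have "\<dots> = ?r"
    unfolding sc_def by (intro nn_integral_PiM_lborel_plus) simp
  finally show ?thesis .
qed

lemma nn_integral_prod_normal_density: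
  fixes n :: nat
  assumes "\<sigma> > 0"
  shows "(\<integral>\<^sup>+y. ennreal (\<Prod>j<n. normal_density (\<mu> j) \<sigma> (y j)) \<partial>PiM {..<n} (\<lambda>_. lborel)) = 1"
proof -
  interpret L: product_sigma_finite "\<lambda>_::nat. lborel :: real measure"
    by (simp add: product_sigma_finite_def sigma_finite_lborel)
  have "(\<integral>\<^sup>+y. (\<Prod>j<n. ennreal (normal_density (\<mu> j) \<sigma> (y j))) \<partial>PiM {..<n} (\<lambda>_. lborel))
    = (\<Prod>j<n. \<integral>\<^sup>+x. ennreal (normal_density (\<mu> j) \<sigma> x) \<partial>lborel)"
    by (intro L.product_nn_integral_prod) auto
  also have "\<dots> = 1"
    using assms by (simp add: nn_integral_eq_integral)
  finally show ?thesis by (simp add: prod_ennreal)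
qed

section \<open>Second moments of the noise\<close>

lemma noise_component:
  assumes "j < n" and [measurable]: "f \<in> borel_measurable borel"
  shows "integrable (noise n) (\<lambda>z. f (z j)) \<longleftrightarrow> integrable std_normal_distribution f"
    and "(\<integral>z. f (z j) \<partial>noise n) = (\<integral>x. f x \<partial>std_normal_distribution :: real)"
proof -
  have D: "distr (noise n) std_normal_distribution (\<lambda>z. z j) = std_normal_distribution"
    unfolding noise_def
    by (rule distr_PiM_component) (use assms prob_space_normal_density[of 1 0] in auto)
  have m: "(\<lambda>z. z j) \<in> noise n \<rightarrow>\<^sub>M std_normal_distribution"
    unfolding noise_def using assms by (intro measurable_component_singleton) auto
  show "integrable (noise n) (\<lambda>z. f (z j)) \<longleftrightarrow> integrable std_normal_distribution f"
    by (subst D[symmetric], subst integrable_distr_eq[OF m]) auto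
  show "(\<integral>z. f (z j) \<partial>noise n) = (\<integral>x. f x \<partial>std_normal_distribution :: real)"
    by (subst D[symmetric], subst integral_distr[OF m]) auto
qed

lemma (in pair_sigma_finite) product_integrable_mult:
  fixes f g :: "_ \<Rightarrow> real"
  assumes "integrable M1 f" and "integrable M2 g"
  shows "integrable (M1 \<Otimes>\<^sub>M M2) (\<lambda>z. f (fst z) * g (snd z))"
    and "(\<integral>z. f (fst z) * g (snd z) \<partial>(M1 \<Otimes>\<^sub>M M2)) = (\<integral>x. f x \<partial>M1) * (\<integral>y. g y \<partial>M2)"
proof -
  have [measurable]: "f \<in> borel_measurable M1" "g \<in> borel_measurable M2"
    using assms by auto
  show i: "integrable (M1 \<Otimes>\<^sub>M M2) (\<lambda>z. f (fst z) * g (snd z))"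
    using assms by (intro Fubini_integrable) (auto simp: abs_mult)
  show "(\<integral>z. f (fst z) * g (snd z) \<partial>(M1 \<Otimes>\<^sub>M M2)) = (\<integral>x. f x \<partial>M1) * (\<integral>y. g y \<partial>M2)"
    using integral_fst'[OF i] by simp
qed

text \<open>The cross terms vanish since the two noises are independent and centred. The affine form
  with three free coefficients covers every square occurring in the logarithm of
  \<open>tilt\<close>.\<close>

lemma noise_pair_second_moment:
  assumes "j < n"
  shows "has_bochner_integral (noise n \<Otimes>\<^sub>M noise n)
    (\<lambda>z. (p + a * fst z j + b * snd z j)\<^sup>2) (p\<^sup>2 + a\<^sup>2 + b\<^sup>2)"
proof -
  interpret N: prob_space "noise n" by (rule prob_space_noise)
  interpret NN: pair_prob_space "noise n" "noise n" ..
  let ?P = "noise n \<Otimes>\<^sub>M noise n"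
  have int: "integrable (noise n) (\<lambda>z. z j ^ k)" for k
    using noise_component(1)[OF assms, of "\<lambda>x. x ^ k"] integrable_std_normal_distribution_moment by simp
  have m1: "(\<integral>z. z j \<partial>noise n) = 0"
    using noise_component(2)[OF assms, of "\<lambda>x. x ^ 1"] integral_std_normal_distribution_moment_odd[of 1] by simp
  have m2: "(\<integral>z. (z j)\<^sup>2 \<partial>noise n) = 1"
    using noise_component(2)[OF assms, of "\<lambda>x. x ^ 2"] std_normal_distribution_even_moments(1)[of 1] by simp
  have hb: "has_bochner_integral ?P (\<lambda>z. fst z j ^ k * snd z j ^ l)
      ((\<integral>z. z j ^ k \<partial>noise n) * (\<integral>z. z j ^ l \<partial>noise n))" for k l
    using NN.product_integrable_mult[OF int[of k] int[of l]] by (simp add: has_bochner_integral_iff)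
  \<comment> \<open>Zeroth powers are written out so that \<open>hb\<close> applies to every
    monomial of the expanded square, the constant included.\<close>
  have "has_bochner_integral ?P (\<lambda>z. p\<^sup>2 * (fst z j ^ 0 * snd z j ^ 0) + a\<^sup>2 * (fst z j ^ 2 * snd z j ^ 0)
      + b\<^sup>2 * (fst z j ^ 0 * snd z j ^ 2) + 2 * p * a * (fst z j ^ 1 * snd z j ^ 0)
      + 2 * p * b * (fst z j ^ 0 * snd z j ^ 1) + 2 * a * b * (fst z j ^ 1 * snd z j ^ 1))
     (p\<^sup>2 * 1 + a\<^sup>2 * 1 + b\<^sup>2 * 1 + 2 * p * a * 0 + 2 * p * b * 0 + 2 * a * b * 0)"
    using hb[of 0 0] hb[of 2 0] hb[of 0 2] hb[of 1 0] hb[of 0 1] hb[of 1 1]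
    by (intro has_bochner_integral_add has_bochner_integral_mult_right) (simp_all add: m1 m2 N.prob_space)
  then show ?thesis
    by (rule has_bochner_integral_cong[THEN iffD1, rotated -1])
       (auto simp: power2_eq_square algebra_simps)
qed

text \<open>
  Replaces Fano's inequality: \<open>w\<close> is the density of a second law with respect to \<open>M\<close>, \<open>A\<close> the
  event of correct decoding and \<open>c\<close> the number of messages; the bound is Jensen's inequality
  for \<open>ln (c\<^sup>\<chi> w)\<close> with \<open>\<chi>\<close> the indicator of \<open>A\<close>.
\<close>

lemma (in prob_space) log_success_bound:
  assumes [measurable]: "w \<in> borel_measurable M" "A \<in> events"
    and pos: "\<And>z. z \<in> space M \<Longrightarrow> 0 < w z"
    and int: "integrable M (\<lambda>z. ln (w z))"
    and le1: "(\<integral>\<^sup>+z. ennreal (w z) \<partial>M) \<le> 1"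
    and leK: "(\<integral>\<^sup>+z. ennreal (w z) * indicator A z \<partial>M) \<le> ennreal K"
    and "0 \<le> K" "1 \<le> c"
  shows "prob A * ln c + (\<integral>z. ln (w z) \<partial>M) \<le> ln 2 - 1 / 2 + c * K / 2"
proof -
  have w: "integrable M w"
    using le1 pos by (intro integrableI_nonneg) (auto simp: le_less_trans less_imp_le)
  have w1: "(\<integral>z. w z \<partial>M) \<le> 1"
    using le1 pos by (subst integral_eq_nn_integral) (auto simp: less_imp_le intro: enn2real_leI)
  have wA: "integrable M (\<lambda>z. w z * indicator A z)"
    using w by (rule integrable_real_mult_indicator[rotated]) simp
  have "(\<integral>\<^sup>+z. ennreal (w z * indicator A z) \<partial>M) \<le> ennreal K"
    using leK by (simp add: ennreal_mult'' ennreal_indicator)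
  then have wA1: "(\<integral>z. w z * indicator A z \<partial>M) \<le> K"
    using pos \<open>0 \<le> K\<close> by (subst integral_eq_nn_integral) (auto simp: less_imp_le intro!: enn2real_leI AE_I2)
  have "prob A * ln c + (\<integral>z. ln (w z) \<partial>M) = (\<integral>z. indicator A z * ln c + ln (w z) \<partial>M)"
    using int by (subst Bochner_Integration.integral_add) (auto simp: emeasure_eq_measure)
  also have "\<dots> \<le> (\<integral>z. ln 2 - 1 + (w z / 2 + c * (w z * indicator A z) / 2) \<partial>M)"
  proof (rule integral_mono)
    show "integrable M (\<lambda>z. indicator A z * ln c + ln (w z))"
      using int by (auto simp: emeasure_eq_measure)
    show "integrable M (\<lambda>z. ln 2 - 1 + (w z / 2 + c * (w z * indicator A z) / 2))"
      using w wA by auto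
    fix z assume z: "z \<in> space M"
    \<comment> \<open>This is \<open>ln u \<le> u - 1\<close> at \<open>u = v * w z / 2\<close>, to
      be used with \<open>v = c\<close> on \<open>A\<close> and \<open>v = 1\<close> off it. The
      halving fits an expectation of \<open>w + c * w * indicator A\<close> of about 2, which is why
      only \<open>ln 2\<close> is lost once \<open>c * K\<close> averages to at most 1.\<close>
    have *: "ln (v * w z) \<le> ln 2 - 1 + v * w z / 2" if "v > 0" for v
      using ln_le_minus_one[of "v * w z / 2"] that pos[OF z] by (simp add: ln_div)
    show "indicator A z * ln c + ln (w z) \<le> ln 2 - 1 + (w z / 2 + c * (w z * indicator A z) / 2)"
      using *[of 1] *[of c] pos[OF z] \<open>1 \<le> c\<close> by (cases "z \<in> A") (auto simp: ln_mult)
  qed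
  also have "\<dots> = ln 2 - 1 + ((\<integral>z. w z \<partial>M) / 2 + c * (\<integral>z. w z * indicator A z \<partial>M) / 2)"
    using w wA by (simp add: prob_space)
  also have "\<dots> \<le> ln 2 - 1 + (1 / 2 + c * K / 2)"
    using w1 wA1 \<open>1 \<le> c\<close> by (intro add_left_mono add_mono divide_right_mono mult_left_mono) auto
  finally show ?thesis by simp
qed

section \<open>Averages over messages\<close>

definition mean :: "nat \<Rightarrow> (nat \<Rightarrow> real) \<Rightarrow> real" where
  "mean M f = (1 / real M) * (\<Sum>m\<in>{1..M}. f m)"

lemma mean_add: "mean M (\<lambda>m. f m + g m) = mean M f + mean M g"
  and mean_diff: "mean M (\<lambda>m. f m - g m) = mean M f - mean M g"
  and mean_cmult: "mean M (\<lambda>m. c * f m) = c * mean M f"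
  and mean_divide: "mean M (\<lambda>m. f m / c) = mean M f / c"
  and mean_const: "M \<ge> 1 \<Longrightarrow> mean M (\<lambda>m. c) = c"
  and mean_sum: "mean M (\<lambda>m. \<Sum>j\<in>J. F j m) = (\<Sum>j\<in>J. mean M (F j))"
  by (simp_all add: mean_def sum.distrib sum_subtractf add_divide_distrib diff_divide_distrib
      sum.swap[of _ J] flip: sum_distrib_left sum_divide_distrib)

lemma mean_mono: "(\<And>m. m \<in> {1..M} \<Longrightarrow> f m \<le> g m) \<Longrightarrow> mean M f \<le> mean M g"
  unfolding mean_def by (intro mult_left_mono sum_mono) auto

lemma mean_mult_right: "mean M (\<lambda>m. f m * c) = mean M f * c"
  using mean_cmult[of M c f] by (simp add: mult.commute)

definition mean3 :: "nat \<Rightarrow> nat \<Rightarrow> nat \<Rightarrow> (nat \<Rightarrow> nat \<Rightarrow> nat \<Rightarrow> real) \<Rightarrow> real" where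
  "mean3 M1 M2 M3 f = mean M1 (\<lambda>m1. mean M2 (\<lambda>m2. mean M3 (\<lambda>m3. f m1 m2 m3)))"

text \<open>The nested form suits the one-variable rules for \<open>mean\<close>; this flat form is
  the one in which \<open>pimac_error\<close> averages.\<close>

lemma mean3_eq: "mean3 M1 M2 M3 f
  = (1 / (real M1 * real M2 * real M3)) * (\<Sum>m1\<in>{1..M1}. \<Sum>m2\<in>{1..M2}. \<Sum>m3\<in>{1..M3}. f m1 m2 m3)"
  by (simp add: mean3_def mean_def mult_ac flip: sum_divide_distrib)

lemma mean3_mono:
  "(\<And>m1 m2 m3. m1 \<in> {1..M1} \<Longrightarrow> m2 \<in> {1..M2} \<Longrightarrow> m3 \<in> {1..M3} \<Longrightarrow> f m1 m2 m3 \<le> g m1 m2 m3)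
    \<Longrightarrow> mean3 M1 M2 M3 f \<le> mean3 M1 M2 M3 g"
  unfolding mean3_def by (intro mean_mono)

lemmas mean3_simps = mean3_def mean_add mean_diff mean_cmult mean_divide mean_mult_right mean_const mean_sum

text \<open>Independent messages make the variance of the sum the sum of the variances, each at most
  a second moment. The centring is essential: codebooks may have nonzero means, and then the
  uncentred cross terms do not vanish.\<close>

lemma mean3_variance:
  assumes "M1 \<ge> 1" "M2 \<ge> 1" "M3 \<ge> 1"
  shows "mean3 M1 M2 M3 (\<lambda>m1 m2 m3. (f m1 + g m2 + h m3 - (mean M1 f + mean M2 g + mean M3 h))\<^sup>2)
    \<le> mean M1 (\<lambda>m. (f m)\<^sup>2) + mean M2 (\<lambda>m. (g m)\<^sup>2) + mean M3 (\<lambda>m. (h m)\<^sup>2)"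
proof -
  let ?c = "mean M1 f + mean M2 g + mean M3 h"
  have "mean3 M1 M2 M3 (\<lambda>m1 m2 m3. (f m1 + g m2 + h m3 - ?c)\<^sup>2)
      = mean3 M1 M2 M3 (\<lambda>m1 m2 m3. (f m1)\<^sup>2 + (g m2)\<^sup>2 + (h m3)\<^sup>2 + ?c\<^sup>2
          + 2 * (f m1 * g m2) + 2 * (f m1 * h m3) + 2 * (g m2 * h m3)
          - 2 * ?c * f m1 - 2 * ?c * g m2 - 2 * ?c * h m3)"
    by (simp add: power2_eq_square algebra_simps)
  also have "\<dots> = mean M1 (\<lambda>m. (f m)\<^sup>2) + mean M2 (\<lambda>m. (g m)\<^sup>2) + mean M3 (\<lambda>m. (h m)\<^sup>2)
      - (mean M1 f)\<^sup>2 - (mean M2 g)\<^sup>2 - (mean M3 h)\<^sup>2"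
    using assms by (simp add: mean3_simps) (simp add: power2_eq_square algebra_simps)
  finally show ?thesis
    using zero_le_power2[of "mean M1 f"] zero_le_power2[of "mean M2 g"] zero_le_power2[of "mean M3 h"] by linarith
qed

section \<open>The one-shot converse\<close>

lemma ln_normal_density:
  assumes "\<sigma> > 0"
  shows "ln (normal_density \<mu> \<sigma> x) = - ln (2 * pi) / 2 - ln (\<sigma>\<^sup>2) / 2 - (x - \<mu>)\<^sup>2 / (2 * \<sigma>\<^sup>2)"
  using assms by (simp add: normal_density_def ln_mult ln_div ln_sqrt add_divide_distrib)

text \<open>The logarithm is a sum of quadratic polynomials in the noises. The constants with
  \<open>2 * pi\<close> cancel between the two densities above and the two below, and the latter
  contribute 1/2 each, which is the summand 1.\<close>

lemma has_bochner_integral_ln_tilt: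
  assumes "\<sigma> > 0" "\<tau> > 0"
  shows "has_bochner_integral (noise n \<Otimes>\<^sub>M noise n) (\<lambda>z. ln (tilt n \<mu> \<sigma> b k \<tau> c d z))
    (\<Sum>j<n. 1 - ln (\<sigma>\<^sup>2) / 2 - ln (\<tau>\<^sup>2) / 2 - ((c j - \<mu> j)\<^sup>2 + 1) / (2 * \<sigma>\<^sup>2)
       - ((d j - b * (c j - k j))\<^sup>2 + b\<^sup>2 + 1) / (2 * \<tau>\<^sup>2))"
proof -
  let ?P = "noise n \<Otimes>\<^sub>M noise n"
  interpret N: prob_space "noise n" by (rule prob_space_noise)
  interpret NN: pair_prob_space "noise n" "noise n" ..
  \<comment> \<open>Each square is padded with coefficients 0 and 1 to match
    \<open>noise_pair_second_moment\<close> literally.\<close>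
  have eq: "ln (tilt n \<mu> \<sigma> b k \<tau> c d z) =
     (\<Sum>j<n. - ln (\<sigma>\<^sup>2) / 2 - ln (\<tau>\<^sup>2) / 2 + (0 + 1 * fst z j + 0 * snd z j)\<^sup>2 / 2 + (0 + 0 * fst z j + 1 * snd z j)\<^sup>2 / 2
        - ((c j - \<mu> j) + 1 * fst z j + 0 * snd z j)\<^sup>2 / (2 * \<sigma>\<^sup>2)
        - ((d j - b * (c j - k j)) + (- b) * fst z j + 1 * snd z j)\<^sup>2 / (2 * \<tau>\<^sup>2))" for z
  proof -
    have pos: "0 < normal_density u \<sigma> v" "0 < normal_density u \<tau> v" "0 < std_normal_density v" for u v
      using assms by (auto intro: normal_density_pos)
    have "ln (tilt n \<mu> \<sigma> b k \<tau> c d z) = (\<Sum>j<n. ln (normal_density (\<mu> j) \<sigma> (c j + fst z j)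
            * normal_density (b * (c j + fst z j - k j)) \<tau> (d j + snd z j)
            / (std_normal_density (fst z j) * std_normal_density (snd z j))))"
      unfolding tilt_def by (intro ln_prod) (simp_all add: pos less_imp_neq[OF pos(1), symmetric]
          less_imp_neq[OF pos(2), symmetric] less_imp_neq[OF pos(3), symmetric])
    also have "\<dots> = (\<Sum>j<n. ln (normal_density (\<mu> j) \<sigma> (c j + fst z j))
            + ln (normal_density (b * (c j + fst z j - k j)) \<tau> (d j + snd z j))
            - (ln (std_normal_density (fst z j)) + ln (std_normal_density (snd z j))))"
      using pos by (intro sum.cong refl) (simp add: ln_div ln_mult less_imp_neq[symmetric])
    also have "\<dots> = (\<Sum>j<n. - ln (\<sigma>\<^sup>2) / 2 - ln (\<tau>\<^sup>2) / 2 + (0 + 1 * fst z j + 0 * snd z j)\<^sup>2 / 2 + (0 + 0 * fst z j + 1 * snd z j)\<^sup>2 / 2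
        - ((c j - \<mu> j) + 1 * fst z j + 0 * snd z j)\<^sup>2 / (2 * \<sigma>\<^sup>2)
        - ((d j - b * (c j - k j)) + (- b) * fst z j + 1 * snd z j)\<^sup>2 / (2 * \<tau>\<^sup>2))"
      using assms by (intro sum.cong refl) (simp add: ln_normal_density algebra_simps)
    finally show ?thesis .
  qed
  have const: "has_bochner_integral ?P (\<lambda>z. r) r" for r :: real
    by (simp add: NN.prob_space has_bochner_integral_iff)
  have "has_bochner_integral ?P (\<lambda>z. ln (tilt n \<mu> \<sigma> b k \<tau> c d z))
    (\<Sum>j<n. - ln (\<sigma>\<^sup>2) / 2 - ln (\<tau>\<^sup>2) / 2 + (0\<^sup>2 + 1\<^sup>2 + 0\<^sup>2) / 2 + (0\<^sup>2 + 0\<^sup>2 + 1\<^sup>2) / 2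
        - ((c j - \<mu> j)\<^sup>2 + 1\<^sup>2 + 0\<^sup>2) / (2 * \<sigma>\<^sup>2)
        - ((d j - b * (c j - k j))\<^sup>2 + (- b)\<^sup>2 + 1\<^sup>2) / (2 * \<tau>\<^sup>2))"
    unfolding eq
    by (intro has_bochner_integral_sum has_bochner_integral_add has_bochner_integral_diff
        has_bochner_integral_divide_zero const noise_pair_second_moment) auto
  then show ?thesis by (simp add: algebra_simps)
qed

text \<open>Under the second law the density of \<open>y\<close> is the same for all messages, and
  that of \<open>t\<close> given \<open>y\<close> depends on \<open>(m1, m2)\<close> only. For fixed
  \<open>y\<close> at most one pair is decoded, and for this pair and fixed \<open>t\<close> at most
  one \<open>m3\<close>. The offset \<open>g\<close> may depend on \<open>(m1, m2)\<close> but not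
  on \<open>m3\<close>, so receiver 2 learns nothing about \<open>m3\<close> from it.\<close>

lemma sum_tilt_success_le_1:
  fixes x1 x2 x3 :: "nat \<Rightarrow> nat \<Rightarrow> real" and d1 :: "(nat \<Rightarrow> real) \<Rightarrow> nat \<times> nat" and d2 :: "(nat \<Rightarrow> real) \<Rightarrow> nat"
  assumes [measurable]: "d1 \<in> measurable (PiM {..<n} (\<lambda>_. borel)) (count_space UNIV)"
      "d2 \<in> measurable (PiM {..<n} (\<lambda>_. borel)) (count_space UNIV)"
    and "\<sigma> > 0" "\<tau> > 0"
  shows "(\<Sum>m1\<in>{1..M1}. \<Sum>m2\<in>{1..M2}. \<Sum>m3\<in>{1..M3}.
     \<integral>\<^sup>+z. ennreal (tilt n \<mu> \<sigma> b (\<lambda>j. x1 m1 j + x2 m2 j) \<tau>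
            (\<lambda>j. x1 m1 j + x2 m2 j + h31 * x3 m3 j) (\<lambda>j. s * x3 m3 j) z)
        * (indicator {y. d1 y = (m1, m2)} (\<lambda>j\<in>{..<n}. x1 m1 j + x2 m2 j + h31 * x3 m3 j + fst z j)
         * indicator {v. d2 v = m3} (\<lambda>j\<in>{..<n}. g m1 m2 j
              + (h31 * (x1 m1 j + x2 m2 j + h31 * x3 m3 j + fst z j) + s * (s * x3 m3 j + snd z j))))
       \<partial>(noise n \<Otimes>\<^sub>M noise n)) \<le> 1"
proof -
  let ?L = "PiM {..<n} (\<lambda>_. lborel) :: (nat \<Rightarrow> real) measure"
  interpret L: product_sigma_finite "\<lambda>_::nat. lborel :: real measure"
    by (simp add: product_sigma_finite_def sigma_finite_lborel)
  interpret L: finite_product_sigma_finite "\<lambda>_::nat. lborel :: real measure" "{..<n}"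
    by standard auto
  define A where "A y = ennreal (\<Prod>j<n. normal_density (\<mu> j) \<sigma> (y j))" for y
  define B where "B m1 m2 y t = ennreal (\<Prod>j<n. normal_density (b * (y j - (x1 m1 j + x2 m2 j))) \<tau> (t j))"
    for m1 m2 and y t :: "nat \<Rightarrow> real"
  define D where "D m1 m2 y t = d2 (\<lambda>j\<in>{..<n}. g m1 m2 j + (h31 * y j + s * t j))"
    for m1 m2 and y t :: "nat \<Rightarrow> real"
  define F :: "nat \<Rightarrow> nat \<Rightarrow> nat \<Rightarrow> (nat \<Rightarrow> real) \<times> (nat \<Rightarrow> real) \<Rightarrow> ennreal"
    where "F m1 m2 m3 p = indicator {y. d1 y = (m1, m2)} (fst p) * indicator {m3} (D m1 m2 (fst p) (snd p))"
    for m1 m2 m3 p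
  have [measurable]: "A \<in> borel_measurable (PiM {..<n} (\<lambda>_. borel))"
    unfolding A_def[abs_def] normal_density_def by measurable
  have Bm [measurable]: "(\<lambda>p. B m1 m2 (fst p) (snd p)) \<in> borel_measurable (PiM {..<n} (\<lambda>_. borel) \<Otimes>\<^sub>M PiM {..<n} (\<lambda>_. borel))" for m1 m2
    unfolding B_def[abs_def] normal_density_def by measurable
  have Dm [measurable]: "(\<lambda>p. D m1 m2 (fst p) (snd p)) \<in> (PiM {..<n} (\<lambda>_. borel) \<Otimes>\<^sub>M PiM {..<n} (\<lambda>_. borel)) \<rightarrow>\<^sub>M count_space UNIV" for m1 m2
    unfolding D_def[abs_def] by measurable
  have [measurable]: "(\<lambda>p. indicator {m3} (D m1 m2 (fst p) (snd p)) :: ennreal)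
      \<in> borel_measurable (PiM {..<n} (\<lambda>_. borel) \<Otimes>\<^sub>M PiM {..<n} (\<lambda>_. borel))" for m1 m2 m3
    by (rule measurable_compose[OF Dm]) simp
  have Fm [measurable]: "F m1 m2 m3 \<in> borel_measurable (PiM {..<n} (\<lambda>_. borel) \<Otimes>\<^sub>M PiM {..<n} (\<lambda>_. borel))" for m1 m2 m3
    unfolding F_def[abs_def] by measurable
  have BF: "(\<lambda>t. B m1 m2 y t * F m1 m2 m3 (y, t)) \<in> borel_measurable ?L"
    if "y \<in> space ?L" for m1 m2 m3 y
  proof -
    have "(\<lambda>t. (y, t)) \<in> ?L \<rightarrow>\<^sub>M PiM {..<n} (\<lambda>_. borel) \<Otimes>\<^sub>M PiM {..<n} (\<lambda>_. borel)"
      using that unfolding measurable_cong_sets[OF sets_PiM_lborel refl]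
        sets_eq_imp_space_eq[OF sets_PiM_lborel] by (rule measurable_Pair1')
    from measurable_compose[OF this, of "\<lambda>p. B m1 m2 (fst p) (snd p) * F m1 m2 m3 p"]
    show ?thesis by simp
  qed
  define I where "I m1 m2 m3 y = (\<integral>\<^sup>+t. B m1 m2 y t * F m1 m2 m3 (y, t) \<partial>?L)" for m1 m2 m3 y
  have Im [measurable]: "I m1 m2 m3 \<in> borel_measurable ?L" for m1 m2 m3
  proof -
    have "(\<lambda>p. B m1 m2 (fst p) (snd p) * F m1 m2 m3 p) \<in> borel_measurable (?L \<Otimes>\<^sub>M ?L)" by measurable
    from L.borel_measurable_nn_integral_fst[OF this] show ?thesis by (simp add: I_def[abs_def])
  qed
  have term_eq: "(\<integral>\<^sup>+z. ennreal (tilt n \<mu> \<sigma> b (\<lambda>j. x1 m1 j + x2 m2 j) \<tau>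
            (\<lambda>j. x1 m1 j + x2 m2 j + h31 * x3 m3 j) (\<lambda>j. s * x3 m3 j) z)
        * (indicator {y. d1 y = (m1, m2)} (\<lambda>j\<in>{..<n}. x1 m1 j + x2 m2 j + h31 * x3 m3 j + fst z j)
         * indicator {v. d2 v = m3} (\<lambda>j\<in>{..<n}. g m1 m2 j
              + (h31 * (x1 m1 j + x2 m2 j + h31 * x3 m3 j + fst z j) + s * (s * x3 m3 j + snd z j))))
       \<partial>(noise n \<Otimes>\<^sub>M noise n)) = (\<integral>\<^sup>+y. A y * I m1 m2 m3 y \<partial>?L)" for m1 m2 m3
  proof -
    have *: "indicator {v. d2 v = m3} (\<lambda>j\<in>{..<n}. g m1 m2 j
              + (h31 * (x1 m1 j + x2 m2 j + h31 * x3 m3 j + p j) + s * (s * x3 m3 j + q j)))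
       = (indicator {m3} (D m1 m2 (\<lambda>j\<in>{..<n}. x1 m1 j + x2 m2 j + h31 * x3 m3 j + p j)
            (\<lambda>j\<in>{..<n}. s * x3 m3 j + q j)) :: ennreal)" for p q
    proof -
      have "(\<lambda>j\<in>{..<n}. g m1 m2 j
              + (h31 * (x1 m1 j + x2 m2 j + h31 * x3 m3 j + p j) + s * (s * x3 m3 j + q j)))
         = (\<lambda>j\<in>{..<n}. g m1 m2 j + (h31 * (\<lambda>j\<in>{..<n}. x1 m1 j + x2 m2 j + h31 * x3 m3 j + p j) j
              + s * (\<lambda>j\<in>{..<n}. s * x3 m3 j + q j) j))"
        by (rule restrict_ext) simp
      then show ?thesis by (simp add: D_def indicator_def)
    qed
    show ?thesis
      using nn_integral_tilt[OF Fm[of m1 m2 m3], of \<mu> \<sigma> b "\<lambda>j. x1 m1 j + x2 m2 j" \<tau>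
            "\<lambda>j. x1 m1 j + x2 m2 j + h31 * x3 m3 j" "\<lambda>j. s * x3 m3 j"]
      unfolding A_def[symmetric] B_def[symmetric] I_def[symmetric] * by (simp add: F_def)
  qed
  have single: "(\<Sum>m\<in>S. indicator {m} a) \<le> (1::ennreal)" if "finite S" for S :: "nat set" and a
    using that card_mono[of "{a}" "S \<inter> {a}"] by (simp add: indicator_def sum.delta')
  \<comment> \<open>The decision of receiver 1 does not involve \<open>t\<close>, so its indicator
    leaves the integral; what remains is a probability density in \<open>t\<close>.\<close>
  have inner: "(\<Sum>m3\<in>{1..M3}. I m1 m2 m3 y) \<le> indicator {y. d1 y = (m1, m2)} y"
    if y: "y \<in> space ?L" for m1 m2 y
  proof -
    have "(\<Sum>m3\<in>{1..M3}. I m1 m2 m3 y) = (\<integral>\<^sup>+t. (\<Sum>m3\<in>{1..M3}. B m1 m2 y t * F m1 m2 m3 (y, t)) \<partial>?L)"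
      unfolding I_def using BF[OF y] by (subst nn_integral_sum) auto
    also have "\<dots> \<le> (\<integral>\<^sup>+t. B m1 m2 y t * indicator {y. d1 y = (m1, m2)} y \<partial>?L)"
    proof (rule nn_integral_mono)
      fix t
      have "(\<Sum>m3\<in>{1..M3}. B m1 m2 y t * F m1 m2 m3 (y, t))
          = B m1 m2 y t * indicator {y. d1 y = (m1, m2)} y * (\<Sum>m3\<in>{1..M3}. indicator {m3} (D m1 m2 y t))"
        by (simp add: F_def sum_distrib_left mult.assoc)
      also have "\<dots> \<le> B m1 m2 y t * indicator {y. d1 y = (m1, m2)} y * 1"
        by (intro mult_left_mono single) auto
      finally show "(\<Sum>m3\<in>{1..M3}. B m1 m2 y t * F m1 m2 m3 (y, t))
          \<le> B m1 m2 y t * indicator {y. d1 y = (m1, m2)} y" by simp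
    qed
    also have "\<dots> = (\<integral>\<^sup>+t. B m1 m2 y t \<partial>?L) * indicator {y. d1 y = (m1, m2)} y"
      by (simp add: indicator_def)
    also have "\<dots> = indicator {y. d1 y = (m1, m2)} y"
      unfolding B_def using nn_integral_prod_normal_density[OF \<open>\<tau> > 0\<close>] by simp
    finally show ?thesis .
  qed
  have outer: "(\<Sum>m1\<in>{1..M1}. \<Sum>m2\<in>{1..M2}. \<Sum>m3\<in>{1..M3}. I m1 m2 m3 y) \<le> 1"
    if y: "y \<in> space ?L" for y
  proof -
    have "(\<Sum>m1\<in>{1..M1}. \<Sum>m2\<in>{1..M2}. \<Sum>m3\<in>{1..M3}. I m1 m2 m3 y)
        \<le> (\<Sum>m1\<in>{1..M1}. \<Sum>m2\<in>{1..M2}. indicator {y. d1 y = (m1, m2)} y)"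
      by (intro sum_mono inner y)
    also have "\<dots> = (\<Sum>m1\<in>{1..M1}. indicator {m1} (fst (d1 y)) * (\<Sum>m2\<in>{1..M2}. indicator {m2} (snd (d1 y))))"
      unfolding sum_distrib_left by (intro sum.cong refl) (auto simp: indicator_def prod_eq_iff)
    also have "\<dots> \<le> (\<Sum>m1\<in>{1..M1}. indicator {m1} (fst (d1 y)) * 1)"
      by (intro sum_mono mult_left_mono single) auto
    also have "\<dots> \<le> 1"
      using single[of "{1..M1}" "fst (d1 y)"] by simp
    finally show ?thesis .
  qed
  have "(\<Sum>m1\<in>{1..M1}. \<Sum>m2\<in>{1..M2}. \<Sum>m3\<in>{1..M3}. (\<integral>\<^sup>+y. A y * I m1 m2 m3 y \<partial>?L))
      = (\<integral>\<^sup>+y. (\<Sum>m1\<in>{1..M1}. \<Sum>m2\<in>{1..M2}. \<Sum>m3\<in>{1..M3}. A y * I m1 m2 m3 y) \<partial>?L)"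
    by (simp add: nn_integral_sum)
  also have "\<dots> = (\<integral>\<^sup>+y. A y * (\<Sum>m1\<in>{1..M1}. \<Sum>m2\<in>{1..M2}. \<Sum>m3\<in>{1..M3}. I m1 m2 m3 y) \<partial>?L)"
    by (simp add: sum_distrib_left)
  also have "\<dots> \<le> (\<integral>\<^sup>+y. A y * 1 \<partial>?L)"
    by (intro nn_integral_mono mult_left_mono outer) auto
  also have "\<dots> = 1"
    unfolding A_def using nn_integral_prod_normal_density[OF \<open>\<sigma> > 0\<close>] by simp
  finally show ?thesis unfolding term_eq .
qed

lemma mean3_add: "mean3 M1 M2 M3 (\<lambda>m1 m2 m3. f m1 m2 m3 + g m1 m2 m3) = mean3 M1 M2 M3 f + mean3 M1 M2 M3 g"
  and mean3_diff: "mean3 M1 M2 M3 (\<lambda>m1 m2 m3. f m1 m2 m3 - g m1 m2 m3) = mean3 M1 M2 M3 f - mean3 M1 M2 M3 g"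
  and mean3_cmult: "mean3 M1 M2 M3 (\<lambda>m1 m2 m3. c * f m1 m2 m3) = c * mean3 M1 M2 M3 f"
  and mean3_divide: "mean3 M1 M2 M3 (\<lambda>m1 m2 m3. f m1 m2 m3 / c) = mean3 M1 M2 M3 f / c"
  and mean3_mult_right: "mean3 M1 M2 M3 (\<lambda>m1 m2 m3. f m1 m2 m3 * c) = mean3 M1 M2 M3 f * c"
  and mean3_const: "M1 \<ge> 1 \<Longrightarrow> M2 \<ge> 1 \<Longrightarrow> M3 \<ge> 1 \<Longrightarrow> mean3 M1 M2 M3 (\<lambda>m1 m2 m3. c) = c"
  and mean3_sum: "mean3 M1 M2 M3 (\<lambda>m1 m2 m3. \<Sum>j\<in>J. F j m1 m2 m3) = (\<Sum>j\<in>J. mean3 M1 M2 M3 (F j))"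
  by (simp_all add: mean3_simps)

lemma nn_integral_tilt_1:
  assumes "\<sigma> > 0" "\<tau> > 0"
  shows "(\<integral>\<^sup>+z. ennreal (tilt n \<mu> \<sigma> b k \<tau> c d z) \<partial>(noise n \<Otimes>\<^sub>M noise n)) = 1"
  using nn_integral_tilt[of "\<lambda>_. 1" n \<mu> \<sigma> b k \<tau> c d] assms
  by (simp add: nn_integral_prod_normal_density)

text \<open>Each receiver's error probability depends only on the law of its own noise, so
  correlating the two noises leaves both unchanged. The union bound then costs a factor 2, harmless
  for an error tending to 0.\<close>

lemma pimac_success_ge:
  fixes v1 v2 :: "nat \<Rightarrow> real" and d1 :: "(nat \<Rightarrow> real) \<Rightarrow> nat \<times> nat" and d2 :: "(nat \<Rightarrow> real) \<Rightarrow> nat"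
  assumes [measurable]: "d1 \<in> measurable (PiM {..<n} (\<lambda>_. borel)) (count_space UNIV)"
      "d2 \<in> measurable (PiM {..<n} (\<lambda>_. borel)) (count_space UNIV)"
    and "a\<^sup>2 + s\<^sup>2 = 1"
  defines "PP \<equiv> noise n \<Otimes>\<^sub>M noise n"
  shows "1 - 2 * measure PP {z \<in> space PP. d1 (\<lambda>j\<in>{..<n}. v1 j + fst z j) \<noteq> p \<or> d2 (\<lambda>j\<in>{..<n}. v2 j + snd z j) \<noteq> m}
    \<le> measure PP {z \<in> space PP. d1 (\<lambda>j\<in>{..<n}. v1 j + fst z j) = p \<and> d2 (\<lambda>j\<in>{..<n}. v2 j + (a * fst z j + s * snd z j)) = m}"
    (is "1 - 2 * measure PP ?E \<le> measure PP ?S")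
proof -
  interpret N: prob_space "noise n" by (rule prob_space_noise)
  interpret NN: pair_prob_space "noise n" "noise n" ..
  interpret P: prob_space PP unfolding PP_def by (rule NN.prob_space_axioms)
  let ?E1 = "{z \<in> space PP. d1 (\<lambda>j\<in>{..<n}. v1 j + fst z j) \<noteq> p}"
  let ?E2 = "\<lambda>a s. {z \<in> space PP. d2 (\<lambda>j\<in>{..<n}. v2 j + (a * fst z j + s * snd z j)) \<noteq> m}"
  have E_sets: "?E \<in> sets PP"
    unfolding PP_def by measurable
  have [measurable]: "?E1 \<in> sets PP" "?E2 a s \<in> sets PP" "?S \<in> sets PP" for a s
    unfolding PP_def by measurable
  \<comment> \<open>The value on the right is free of \<open>a\<close> and \<open>s\<close>; the
    original channel is the case \<open>a = 0\<close>, \<open>s = 1\<close>.\<close>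
  have E2: "measure PP (?E2 a s) = measure (noise n) {z \<in> space (noise n). d2 (\<lambda>j\<in>{..<n}. v2 j + z j) \<noteq> m}"
    if "a\<^sup>2 + s\<^sup>2 = 1" for a s
  proof -
    let ?f = "\<lambda>z. \<lambda>j\<in>{..<n}. a * fst z j + s * snd z j"
    have f: "?f \<in> PP \<rightarrow>\<^sub>M noise n"
      unfolding PP_def by measurable
    have "measure (noise n) {z \<in> space (noise n). d2 (\<lambda>j\<in>{..<n}. v2 j + z j) \<noteq> m}
      = measure (distr PP (noise n) ?f) {z \<in> space (noise n). d2 (\<lambda>j\<in>{..<n}. v2 j + z j) \<noteq> m}"
      using noise_pair_rotation[OF that] by (simp add: PP_def)
    also have "\<dots> = measure PP (?f -` {z \<in> space (noise n). d2 (\<lambda>j\<in>{..<n}. v2 j + z j) \<noteq> m} \<inter> space PP)"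
      by (rule measure_distr[OF f]) measurable
    also have "?f -` {z \<in> space (noise n). d2 (\<lambda>j\<in>{..<n}. v2 j + z j) \<noteq> m} \<inter> space PP = ?E2 a s"
    proof -
      have "(\<lambda>j\<in>{..<n}. v2 j + ?f z j) = (\<lambda>j\<in>{..<n}. v2 j + (a * fst z j + s * snd z j))" for z
        by (rule restrict_ext) simp
      then show ?thesis using measurable_space[OF f] by auto
    qed
    finally show ?thesis by (rule sym)
  qed
  have "1 - measure PP ?S = measure PP (space PP - ?S)"
    by (rule P.prob_compl[symmetric]) measurable
  also have "\<dots> = measure PP (?E1 \<union> ?E2 a s)"
    by (intro arg_cong[where f = "measure PP"]) auto
  also have "\<dots> \<le> measure PP ?E1 + measure PP (?E2 a s)"
    by (rule measure_Un_le) measurable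
  also have "measure PP (?E2 a s) = measure PP (?E2 0 1)"
    using E2[OF assms(3)] E2[of 0 1] by simp
  also have "measure PP (?E2 0 1) \<le> measure PP ?E"
    by (rule P.finite_measure_mono[OF _ E_sets]) auto
  also have "measure PP ?E1 \<le> measure PP ?E"
    by (rule P.finite_measure_mono[OF _ E_sets]) auto
  finally show ?thesis by linarith
qed

text \<open>\<open>log_success_bound\<close> is applied to each message triple and averaged. The
  remainder \<open>ln 2\<close> does not grow with \<open>n\<close>, so it disappears after
  normalising by the blocklength.\<close>

lemma pimac_one_shot_converse:
  fixes x1 x2 x3 :: "nat \<Rightarrow> nat \<Rightarrow> real" and d1 :: "(nat \<Rightarrow> real) \<Rightarrow> nat \<times> nat" and d2 :: "(nat \<Rightarrow> real) \<Rightarrow> nat"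
  assumes n: "n \<ge> 1" and M: "M1 \<ge> 1" "M2 \<ge> 1" "M3 \<ge> 1"
    and P: "P1 \<ge> 0" "P2 \<ge> 0" "P3 \<ge> 0" and h: "h31\<^sup>2 \<le> 1"
    and pow: "power_ok n M1 x1 P1" "power_ok n M2 x2 P2" "power_ok n M3 x3 P3"
    and d [measurable]: "d1 \<in> measurable (PiM {..<n} (\<lambda>_. borel)) (count_space UNIV)"
      "d2 \<in> measurable (PiM {..<n} (\<lambda>_. borel)) (count_space UNIV)"
  shows "(1 - 2 * pimac_error h12 h22 h31 n M1 M2 M3 x1 x2 x3 d1 d2) * ln (real M1 * real M2 * real M3)
    \<le> real n / 2 * (ln (1 + P1 + P2 + h31\<^sup>2 * P3) + ln ((1 + P3) / (1 + h31\<^sup>2 * P3))) + ln 2"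
proof -
  \<comment> \<open>\<open>S\<close> is the variance of the first output for independent centred
    inputs of full power. The weight \<open>s\<close> completes \<open>h31 * Z\<close> to
    unit-variance noise.\<close>
  define S where "S = 1 + P1 + P2 + h31\<^sup>2 * P3"
  define T where "T = (1 + P3) / (1 + h31\<^sup>2 * P3)"
  define s where "s = sqrt (1 - h31\<^sup>2)"
  \<comment> \<open>\<open>b\<close> and \<open>T\<close> are the coefficient and the error variance of the linear MMSE estimate of
    \<open>s X + W\<close> from \<open>h31 X + Z\<close> when \<open>X\<close> has variance \<open>P3\<close>.\<close>
  define b where "b = s * h31 * P3 / (1 + h31\<^sup>2 * P3)"
  have D: "1 + h31\<^sup>2 * P3 > 0"
    using P by (intro add_pos_nonneg) auto
  have S: "S > 0" unfolding S_def using P by (intro add_pos_nonneg) auto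
  have T: "T > 0" unfolding T_def using P D by (intro divide_pos_pos) auto
  have s2: "s\<^sup>2 = 1 - h31\<^sup>2" using h by (simp add: s_def)
  have hs: "h31\<^sup>2 + s\<^sup>2 = 1" by (simp add: s2)
  \<comment> \<open>The left side is the variance of the residual
    \<open>s X + W - b (h31 X + Z)\<close>.\<close>
  have T_eq: "(s - b * h31)\<^sup>2 * P3 + b\<^sup>2 + 1 = T"
  proof -
    have "s - b * h31 = s / (1 + h31\<^sup>2 * P3)"
      using D by (simp add: b_def field_simps power2_eq_square)
    then have "(s - b * h31)\<^sup>2 * P3 + b\<^sup>2 = s\<^sup>2 * P3 * (1 + h31\<^sup>2 * P3) / (1 + h31\<^sup>2 * P3)\<^sup>2"
      by (simp add: b_def power_divide power_mult_distrib add_divide_distrib[symmetric])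
        (simp add: algebra_simps power2_eq_square)
    also have "\<dots> = s\<^sup>2 * P3 / (1 + h31\<^sup>2 * P3)"
      using D by (simp add: power2_eq_square)
    finally show ?thesis
      using D by (simp add: T_def s2 field_simps)
  qed
  define \<sigma> where "\<sigma> = sqrt S"
  define \<tau> where "\<tau> = sqrt T"
  have \<sigma>: "\<sigma> > 0" "\<sigma>\<^sup>2 = S" and \<tau>: "\<tau> > 0" "\<tau>\<^sup>2 = T"
    using S T by (auto simp: \<sigma>_def \<tau>_def)
  define \<mu> where "\<mu> j = mean M1 (\<lambda>m. x1 m j) + mean M2 (\<lambda>m. x2 m j) + mean M3 (\<lambda>m. h31 * x3 m j)" for j
  \<comment> \<open>\<open>k\<close> is the part of the first output fixed by
    \<open>(m1, m2)\<close>; \<open>c\<close>, \<open>e\<close> and \<open>v\<close> are the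
    noise-free first output, auxiliary observation and second output.\<close>
  define k where "k m1 m2 j = x1 m1 j + x2 m2 j" for m1 m2 j
  define c where "c m1 m2 m3 j = x1 m1 j + x2 m2 j + h31 * x3 m3 j" for m1 m2 m3 j
  define e where "e m3 j = s * x3 m3 j" for m3 j
  define v where "v m1 m2 m3 j = h12 * x1 m1 j + h22 * x2 m2 j + x3 m3 j" for m1 m2 m3 j
  define w where "w m1 m2 m3 = tilt n \<mu> \<sigma> b (k m1 m2) \<tau> (c m1 m2 m3) (e m3)" for m1 m2 m3
  let ?PP = "noise n \<Otimes>\<^sub>M noise n"
  interpret N: prob_space "noise n" by (rule prob_space_noise)
  interpret NN: pair_prob_space "noise n" "noise n" ..
  \<comment> \<open>\<open>A\<close> uses the correlated noise at receiver 2, whereas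
    \<open>err\<close> keeps the independent noises of the channel.\<close>
  define A where "A m1 m2 m3 = {z \<in> space ?PP. d1 (\<lambda>j\<in>{..<n}. c m1 m2 m3 j + fst z j) = (m1, m2)
      \<and> d2 (\<lambda>j\<in>{..<n}. v m1 m2 m3 j + (h31 * fst z j + s * snd z j)) = m3}" for m1 m2 m3
  define err where "err m1 m2 m3 = measure ?PP {z \<in> space ?PP. d1 (\<lambda>j\<in>{..<n}. c m1 m2 m3 j + fst z j) \<noteq> (m1, m2)
      \<or> d2 (\<lambda>j\<in>{..<n}. v m1 m2 m3 j + snd z j) \<noteq> m3}" for m1 m2 m3
  define K where "K m1 m2 m3 = (\<integral>\<^sup>+z. ennreal (w m1 m2 m3 z) * indicator (A m1 m2 m3) z \<partial>?PP)" for m1 m2 m3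
  define L where "L m1 m2 m3 = (\<integral>z. ln (w m1 m2 m3 z) \<partial>?PP)" for m1 m2 m3
  define MM where "MM = real M1 * real M2 * real M3"
  have MM1: "1 \<le> MM"
  proof -
    have "1 \<le> real (M1 * M2 * M3)" using M by (simp del: of_nat_mult)
    then show ?thesis by (simp add: MM_def)
  qed
  have A_sets: "A m1 m2 m3 \<in> sets ?PP" for m1 m2 m3
    unfolding A_def by measurable

  \<comment> \<open>Success probability under the tilted law\<close>
  have K_sum: "(\<Sum>m1\<in>{1..M1}. \<Sum>m2\<in>{1..M2}. \<Sum>m3\<in>{1..M3}. K m1 m2 m3) \<le> 1"
  proof -
    \<comment> \<open>This offset replaces the share \<open>h31 * (x1 + x2)\<close> brought in by
      \<open>h31 * Y\<close> by the true interference at receiver 2;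
      \<open>h31\<^sup>2 + s\<^sup>2 = 1\<close> gives \<open>x3\<close> its coefficient 1.\<close>
    define g where "g m1 m2 j = h12 * x1 m1 j + h22 * x2 m2 j - h31 * (x1 m1 j + x2 m2 j)" for m1 m2 j
    have "K m1 m2 m3 = (\<integral>\<^sup>+z. ennreal (tilt n \<mu> \<sigma> b (\<lambda>j. x1 m1 j + x2 m2 j) \<tau>
            (\<lambda>j. x1 m1 j + x2 m2 j + h31 * x3 m3 j) (\<lambda>j. s * x3 m3 j) z)
        * (indicator {y. d1 y = (m1, m2)} (\<lambda>j\<in>{..<n}. x1 m1 j + x2 m2 j + h31 * x3 m3 j + fst z j)
         * indicator {v. d2 v = m3} (\<lambda>j\<in>{..<n}. g m1 m2 j
              + (h31 * (x1 m1 j + x2 m2 j + h31 * x3 m3 j + fst z j) + s * (s * x3 m3 j + snd z j)))) \<partial>?PP)" for m1 m2 m3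
    proof -
      have *: "g m1 m2 j + (h31 * (x1 m1 j + x2 m2 j + h31 * x3 m3 j + p) + s * (s * x3 m3 j + q))
          = v m1 m2 m3 j + (h31 * p + s * q)" for j p q
      proof -
        have "g m1 m2 j + (h31 * (x1 m1 j + x2 m2 j + h31 * x3 m3 j + p) + s * (s * x3 m3 j + q))
          = h12 * x1 m1 j + h22 * x2 m2 j + (h31\<^sup>2 + s\<^sup>2) * x3 m3 j + (h31 * p + s * q)"
          by (simp add: g_def algebra_simps power2_eq_square)
        then show ?thesis by (simp add: hs v_def)
      qed
      show ?thesis
        unfolding K_def w_def * k_def[abs_def] c_def[abs_def] e_def[abs_def] A_def
        by (intro nn_integral_cong) (auto simp: indicator_def)
    qed
    then show ?thesis
      using sum_tilt_success_le_1[OF d \<sigma>(1) \<tau>(1)] by simp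
  qed
  have w_le1: "(\<integral>\<^sup>+z. ennreal (w m1 m2 m3 z) \<partial>?PP) \<le> 1" for m1 m2 m3
    unfolding w_def using nn_integral_tilt_1[OF \<sigma>(1) \<tau>(1)] by simp
  \<comment> \<open>Finiteness matters because \<open>enn2real\<close> sends infinity to 0.\<close>
  have K_fin: "K m1 m2 m3 \<noteq> \<top>" for m1 m2 m3
  proof -
    have "K m1 m2 m3 \<le> (\<integral>\<^sup>+z. ennreal (w m1 m2 m3 z) \<partial>?PP)"
      unfolding K_def by (intro nn_integral_mono) (auto simp: indicator_def)
    with w_le1[of m1 m2 m3] show ?thesis by (auto simp: top_unique)
  qed
  have K_mean: "mean3 M1 M2 M3 (\<lambda>m1 m2 m3. enn2real (K m1 m2 m3)) * MM \<le> 1"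
  proof -
    have "ennreal (\<Sum>m1\<in>{1..M1}. \<Sum>m2\<in>{1..M2}. \<Sum>m3\<in>{1..M3}. enn2real (K m1 m2 m3)) \<le> 1"
      using K_sum K_fin by (simp add: sum_nonneg less_top flip: sum_ennreal)
    then show ?thesis
      using M by (simp add: mean3_eq MM_def)
  qed

  \<comment> \<open>Expected log-likelihood ratio under the power constraints\<close>
  have step: "measure ?PP (A m1 m2 m3) * ln MM + L m1 m2 m3 \<le> ln 2 - 1 / 2 + MM * enn2real (K m1 m2 m3) / 2" for m1 m2 m3
    unfolding L_def
  proof (rule NN.log_success_bound[OF _ A_sets])
    show "w m1 m2 m3 \<in> borel_measurable ?PP"
      unfolding w_def by measurable
    show "0 < w m1 m2 m3 z" for z
      unfolding w_def tilt_def using \<sigma> \<tau>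
      by (intro prod_pos divide_pos_pos mult_pos_pos normal_density_pos) auto
    show "integrable ?PP (\<lambda>z. ln (w m1 m2 m3 z))"
      unfolding w_def using has_bochner_integral_ln_tilt[OF \<sigma>(1) \<tau>(1)] by (rule integrable.intros)
    show "(\<integral>\<^sup>+z. ennreal (w m1 m2 m3 z) * indicator (A m1 m2 m3) z \<partial>?PP) \<le> ennreal (enn2real (K m1 m2 m3))"
      using K_fin[of m1 m2 m3] by (simp add: K_def less_top)
  qed (use w_le1 MM1 in auto)
  \<comment> \<open>Since \<open>c - k\<close> is \<open>h31 * x3\<close>, the mean of the residual
    is \<open>(s - b * h31) * x3\<close>: inputs 1 and 2 drop out of the second quadratic
    term.\<close>
  have L_eq: "L m1 m2 m3 = (\<Sum>j<n. 1 - ln S / 2 - ln T / 2 - ((c m1 m2 m3 j - \<mu> j)\<^sup>2 + 1) / (2 * S)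
       - ((s - b * h31)\<^sup>2 * (x3 m3 j)\<^sup>2 + b\<^sup>2 + 1) / (2 * T))" for m1 m2 m3
  proof -
    have "(e m3 j - b * (c m1 m2 m3 j - k m1 m2 j))\<^sup>2 = (s - b * h31)\<^sup>2 * (x3 m3 j)\<^sup>2" for j
      by (simp add: e_def c_def k_def power2_eq_square algebra_simps)
    then show ?thesis
      unfolding L_def w_def
      using has_bochner_integral_integral_eq[OF has_bochner_integral_ln_tilt[OF \<sigma>(1) \<tau>(1)]] by (simp add: \<sigma> \<tau>)
  qed
  have L_mean: "mean3 M1 M2 M3 L \<ge> - (real n / 2 * (ln S + ln T))"
  proof -
    define q where "q M x j = mean M (\<lambda>m. (x m j)\<^sup>2)" for M and x :: "nat \<Rightarrow> nat \<Rightarrow> real" and j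
    have q_le: "(\<Sum>j<n. q M x j) \<le> real n * P" if "power_ok n M x P" for M x P
      using that n by (simp add: power_ok_def q_def mean_def field_simps)
    have var: "mean3 M1 M2 M3 (\<lambda>m1 m2 m3. (c m1 m2 m3 j - \<mu> j)\<^sup>2) \<le> q M1 x1 j + q M2 x2 j + h31\<^sup>2 * q M3 x3 j" for j
      using mean3_variance[OF M, of "\<lambda>m. x1 m j" "\<lambda>m. x2 m j" "\<lambda>m. h31 * x3 m j"]
      by (simp add: c_def \<mu>_def q_def power_mult_distrib mean_cmult)
    \<comment> \<open>At full power each quadratic term equals \<open>n / 2\<close>, and together
      they cancel the \<open>n\<close> coming from the summands 1. Smaller actual powers only
      increase the expression, as all powers enter with nonpositive coefficients.\<close>
    have "- (real n / 2 * (ln S + ln T)) = real n * (1 - ln S / 2 - ln T / 2)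
        - real n * S / (2 * S) - real n * ((s - b * h31)\<^sup>2 * P3 + b\<^sup>2 + 1) / (2 * T)"
      unfolding T_eq using S T by (simp add: field_simps)
    also have "\<dots> = real n * (1 - ln S / 2 - ln T / 2)
        - (real n * P1 + real n * P2 + h31\<^sup>2 * (real n * P3) + real n) / (2 * S)
        - ((s - b * h31)\<^sup>2 * (real n * P3) + real n * (b\<^sup>2 + 1)) / (2 * T)"
      by (simp add: S_def algebra_simps)
    also have "\<dots> \<le> real n * (1 - ln S / 2 - ln T / 2)
        - ((\<Sum>j<n. q M1 x1 j) + (\<Sum>j<n. q M2 x2 j) + h31\<^sup>2 * (\<Sum>j<n. q M3 x3 j) + real n) / (2 * S)
        - ((s - b * h31)\<^sup>2 * (\<Sum>j<n. q M3 x3 j) + real n * (b\<^sup>2 + 1)) / (2 * T)"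
      using S T pow by (intro diff_mono order_refl divide_right_mono add_mono mult_left_mono q_le) auto
    also have "\<dots> = (\<Sum>j<n. 1 - ln S / 2 - ln T / 2 - ((q M1 x1 j + q M2 x2 j + h31\<^sup>2 * q M3 x3 j) + 1) / (2 * S)
       - ((s - b * h31)\<^sup>2 * q M3 x3 j + b\<^sup>2 + 1) / (2 * T))"
      by (simp add: sum.distrib sum_subtractf add_divide_distrib diff_divide_distrib distrib_left right_diff_distrib
          flip: sum_distrib_left sum_divide_distrib)
    also have "\<dots> \<le> (\<Sum>j<n. 1 - ln S / 2 - ln T / 2 - (mean3 M1 M2 M3 (\<lambda>m1 m2 m3. (c m1 m2 m3 j - \<mu> j)\<^sup>2) + 1) / (2 * S)
       - ((s - b * h31)\<^sup>2 * q M3 x3 j + b\<^sup>2 + 1) / (2 * T))"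
      using S by (intro sum_mono diff_mono order_refl divide_right_mono add_mono var) auto
    also have "\<dots> = mean3 M1 M2 M3 L"
    proof -
      have "q M3 x3 j = mean3 M1 M2 M3 (\<lambda>m1 m2 m3. (x3 m3 j)\<^sup>2)" for j
        using M by (simp add: q_def mean3_simps)
      then show ?thesis
        using M by (simp add: L_eq[abs_def] mean3_sum mean3_add mean3_diff mean3_divide mean3_cmult mean3_const)
    qed
    finally show ?thesis .
  qed

  \<comment> \<open>Averaging over the messages\<close>
  have error_eq: "pimac_error h12 h22 h31 n M1 M2 M3 x1 x2 x3 d1 d2 = mean3 M1 M2 M3 err"
    unfolding pimac_error_def mean3_eq err_def c_def v_def by simp
  have "(1 - 2 * mean3 M1 M2 M3 err) * ln MM = mean3 M1 M2 M3 (\<lambda>m1 m2 m3. (1 - 2 * err m1 m2 m3) * ln MM)"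
    using M by (simp add: mean3_mult_right mean3_diff mean3_cmult mean3_const)
  also have "\<dots> \<le> mean3 M1 M2 M3 (\<lambda>m1 m2 m3. ln 2 - 1 / 2 + MM * enn2real (K m1 m2 m3) / 2 - L m1 m2 m3)"
  proof (rule mean3_mono)
    fix m1 m2 m3
    have "1 - 2 * err m1 m2 m3 \<le> measure ?PP (A m1 m2 m3)"
      unfolding err_def A_def by (rule pimac_success_ge[OF d hs])
    then have "(1 - 2 * err m1 m2 m3) * ln MM \<le> measure ?PP (A m1 m2 m3) * ln MM"
      using MM1 by (intro mult_right_mono) auto
    also have "\<dots> \<le> ln 2 - 1 / 2 + MM * enn2real (K m1 m2 m3) / 2 - L m1 m2 m3"
      using step[of m1 m2 m3] by simp
    finally show "(1 - 2 * err m1 m2 m3) * ln MM \<le> ln 2 - 1 / 2 + MM * enn2real (K m1 m2 m3) / 2 - L m1 m2 m3" .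
  qed
  also have "\<dots> = ln 2 - 1 / 2 + mean3 M1 M2 M3 (\<lambda>m1 m2 m3. enn2real (K m1 m2 m3)) * MM / 2 - mean3 M1 M2 M3 L"
    using M by (simp add: mean3_add mean3_diff mean3_divide mean3_cmult mean3_const)
  \<comment> \<open>The averaged success term is at most 1/2 and offsets the constant -1/2.\<close>
  also have "\<dots> \<le> ln 2 - 1 / 2 + 1 / 2 - - (real n / 2 * (ln S + ln T))"
    using K_mean L_mean by (intro diff_mono add_mono divide_right_mono) auto
  finally show ?thesis
    unfolding error_eq MM_def S_def T_def by simp
qed

section \<open>The sum-capacity\<close>

text \<open>Rounding up can only add messages, which is the direction a converse needs; at least one
  message keeps the logarithms and averages meaningful.\<close>

lemma ln_msg_num_ge:
  shows "real n * R * ln 2 \<le> ln (real (msg_num n R))" and "1 \<le> msg_num n R"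
proof -
  have pos: "0 < 2 powr (real n * R)" by simp
  have le: "2 powr (real n * R) \<le> real (msg_num n R)"
    unfolding msg_num_def by (rule of_nat_ceiling)
  with pos have M: "0 < real (msg_num n R)" by (rule less_le_trans)
  then show "1 \<le> msg_num n R" by simp
  have "ln (2 powr (real n * R)) \<le> ln (real (msg_num n R))"
    using le pos M by (subst ln_le_cancel_iff)
  then show "real n * R * ln 2 \<le> ln (real (msg_num n R))" by (simp add: ln_powr)
qed

text \<open>The one-shot bound is divided by \<open>n\<close>; in the limit both the error and
  \<open>ln 2 / n\<close> vanish.\<close>

lemma pimac_achievable_sum_le:
  assumes ach: "pimac_achievable h12 h22 h31 P1 P2 P3 (R1, R2, R3)"
    and P: "P1 \<ge> 0" "P2 \<ge> 0" "P3 \<ge> 0" and h: "h31\<^sup>2 \<le> 1"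
  shows "R1 + R2 + R3 \<le> 1/2 * log 2 (1 + (P1 + P2) / (1 + h31\<^sup>2 * P3)) + 1/2 * log 2 (1 + P3)"
proof -
  obtain x1 x2 x3 :: "nat \<Rightarrow> nat \<Rightarrow> nat \<Rightarrow> real"
    and d1 :: "nat \<Rightarrow> (nat \<Rightarrow> real) \<Rightarrow> nat \<times> nat" and d2 :: "nat \<Rightarrow> (nat \<Rightarrow> real) \<Rightarrow> nat"
    where code: "\<And>n. n \<ge> 1 \<Longrightarrow> pimac_code n R1 R2 R3 P1 P2 P3 (x1 n) (x2 n) (x3 n) (d1 n) (d2 n)"
      and lim: "(\<lambda>n. pimac_error h12 h22 h31 n (msg_num n R1) (msg_num n R2) (msg_num n R3)
                   (x1 n) (x2 n) (x3 n) (d1 n) (d2 n)) \<longlonglongrightarrow> 0"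
    using ach unfolding pimac_achievable_def prod.case by blast
  define \<epsilon> where "\<epsilon> n = pimac_error h12 h22 h31 n (msg_num n R1) (msg_num n R2) (msg_num n R3)
                   (x1 n) (x2 n) (x3 n) (d1 n) (d2 n)" for n
  define C where "C = (ln (1 + P1 + P2 + h31\<^sup>2 * P3) + ln ((1 + P3) / (1 + h31\<^sup>2 * P3))) / 2"
  have lim\<epsilon>: "\<epsilon> \<longlonglongrightarrow> 0" using lim unfolding \<epsilon>_def .
  \<comment> \<open>An error below 1/2 makes the factor \<open>1 - 2 * \<epsilon> n\<close>
    nonnegative, so that the lower bound on the number of messages can be multiplied by it.\<close>
  have bound: "(1 - 2 * \<epsilon> n) * ((R1 + R2 + R3) * ln 2) \<le> C + ln 2 / real n" if n: "n \<ge> 1" and \<epsilon>: "\<epsilon> n < 1 / 2" for n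
  proof -
    let ?M = "\<lambda>R. msg_num n R"
    have pos: "0 < real (?M R)" for R using ln_msg_num_ge(2)[of n R] by simp
    have "(1 - 2 * \<epsilon> n) * (real n * ((R1 + R2 + R3) * ln 2)) \<le> (1 - 2 * \<epsilon> n) * ln (real (?M R1) * real (?M R2) * real (?M R3))"
    proof (rule mult_left_mono)
      show "real n * ((R1 + R2 + R3) * ln 2) \<le> ln (real (?M R1) * real (?M R2) * real (?M R3))"
        using ln_msg_num_ge(1)[of n R1] ln_msg_num_ge(1)[of n R2] ln_msg_num_ge(1)[of n R3] pos[of R1] pos[of R2] pos[of R3]
        by (simp add: ln_mult algebra_simps)
    qed (use \<epsilon> in simp)
    also have "\<dots> \<le> real n / 2 * (ln (1 + P1 + P2 + h31\<^sup>2 * P3) + ln ((1 + P3) / (1 + h31\<^sup>2 * P3))) + ln 2"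
      unfolding \<epsilon>_def
      by (rule pimac_one_shot_converse)
         (use n P h code[OF n] ln_msg_num_ge(2) in \<open>auto simp: pimac_code_def\<close>)
    also have "\<dots> = real n * (C + ln 2 / real n)"
      using n by (simp add: C_def field_simps)
    finally have "real n * ((1 - 2 * \<epsilon> n) * ((R1 + R2 + R3) * ln 2)) \<le> real n * (C + ln 2 / real n)"
      by (simp add: mult_ac)
    then show ?thesis using n by (subst (asm) mult_le_cancel_left_pos) auto
  qed
  have "(R1 + R2 + R3) * ln 2 \<le> C"
  proof (rule tendsto_le[OF sequentially_bot])
    show "(\<lambda>n. C + ln 2 / real n) \<longlonglongrightarrow> C"
      using tendsto_add[OF tendsto_const lim_const_over_n[of "ln 2 :: real"]] by simp
    show "(\<lambda>n. (1 - 2 * \<epsilon> n) * ((R1 + R2 + R3) * ln 2)) \<longlonglongrightarrow> (R1 + R2 + R3) * ln 2"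
      using tendsto_mult_right[OF tendsto_diff[OF tendsto_const tendsto_mult_left[OF lim\<epsilon>, of 2]], of 1 "(R1 + R2 + R3) * ln 2"]
      by simp
    have "\<forall>\<^sub>F n in sequentially. \<epsilon> n < 1 / 2"
      using lim\<epsilon> by (rule order_tendstoD) simp
    then show "\<forall>\<^sub>F n in sequentially. (1 - 2 * \<epsilon> n) * ((R1 + R2 + R3) * ln 2) \<le> C + ln 2 / real n"
      using eventually_ge_at_top[of 1] by eventually_elim (rule bound)
  qed
  \<comment> \<open>The denominator \<open>1 + h31\<^sup>2 * P3\<close> moves from the second
    logarithm to the first; the factor \<open>ln 2\<close> converts bits to nats.\<close>
  moreover have "C = (1/2 * log 2 (1 + (P1 + P2) / (1 + h31\<^sup>2 * P3)) + 1/2 * log 2 (1 + P3)) * ln 2"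
  proof -
    have D: "1 + h31\<^sup>2 * P3 > 0" using P by (intro add_pos_nonneg) auto
    have S: "1 + P1 + P2 + h31\<^sup>2 * P3 > 0" using P by (intro add_pos_nonneg) auto
    have "1 + (P1 + P2) / (1 + h31\<^sup>2 * P3) = (1 + P1 + P2 + h31\<^sup>2 * P3) / (1 + h31\<^sup>2 * P3)"
      using D by (simp add: field_simps)
    then show ?thesis
      using D S P by (simp add: C_def log_def ln_div field_simps)
  qed
  ultimately show ?thesis by simp
qed

text \<open>At rate 0 there is a single message, and constant decoders never err. This makes the
  capacity region nonempty, without which \<open>Sup\<close> would be an unspecified value.\<close>

lemma pimac_achievable_zero:
  assumes "P1 \<ge> 0" "P2 \<ge> 0" "P3 \<ge> 0"
  shows "pimac_achievable h12 h22 h31 P1 P2 P3 (0, 0, 0)"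
proof -
  have M: "msg_num n 0 = 1" for n by (simp add: msg_num_def)
  show ?thesis
    unfolding pimac_achievable_def prod.case
    by (intro conjI exI[of _ "\<lambda>_ _ _. 0"] exI[of _ "\<lambda>_ _. (1, 1)"] exI[of _ "\<lambda>_ _. 1"])
       (use assms in \<open>auto simp: M pimac_code_def power_ok_def pimac_error_def\<close>)
qed

theorem theorem1:
  fixes h12 h22 h31 P1 P2 P3 :: real
  assumes "P1 \<ge> 0" and "P2 \<ge> 0" and "P3 \<ge> 0"
    and "h31\<^sup>2 \<le> 1"
  shows "pimac_sum_capacity h12 h22 h31 P1 P2 P3
           \<le> 1/2 * log 2 (1 + (P1 + P2) / (1 + h31\<^sup>2 * P3)) + 1/2 * log 2 (1 + P3)"
  unfolding pimac_sum_capacity_def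
proof (rule cSup_least)
  show "(\<lambda>(R1, R2, R3). R1 + R2 + R3) ` pimac_capacity_region h12 h22 h31 P1 P2 P3 \<noteq> {}"
    using pimac_achievable_zero[OF assms(1-3), of h12 h22 h31] by (auto simp: pimac_capacity_region_def)
qed (use pimac_achievable_sum_le assms in \<open>auto simp: pimac_capacity_region_def\<close>)

end
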